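(* Consider the noisy voter model $\{\eta_t\}_{t\ge0}$ corresponding to continuous time random walk with rate 1 on the $n$-star, with $n$ even, and let $\mu^{\eta}_t$ be its law at time $t$ started from $\eta$ and $\mu_\infty$ its stationary distribution. (i) Let $\eta_0$ be any configuration which is 1 on exactly half of the leaves. If $n\ge 3$ and $C\in\mathbb{R}$ is such that $t=\frac14(\log n-C)>0$, then $$\|\mu^{\eta_0}_t-\mu_\infty\|_{\mathtt{TV}}\ge\frac{e^{C}}{48+e^{C}}.$$ (ii) The time it takes for the distribution started from all 1's to be within distance $1/4$ in total variation norm of the stationary distribution is $O(1)$; that is, there is a constant $K$ such that for all even $n$, $$\inf\bigl\{t\ge0:\|\mu^{\mathbf 1}_t-\mu_\infty\|_{\mathtt{TV}}\le \tfrac14\bigr\}\le K,$$ where $\mathbf 1$ denotes the configuration of all 1's.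
   Context: The $n$-star is the graph with one central vertex and $n$ leaves, each leaf joined by an edge to the center only. Continuous time random walk with rate (parameter) 1 on a graph waits an exponential time with parameter 1 and then moves to a uniformly chosen neighbor; on the $n$-star its rates are $q(\text{leaf},\text{center})=1$, $q(\text{center},\text{leaf})=1/n$ for each leaf, and $0$ otherwise. Given rates $q(x,y)\ge0$ ($x\ne y$) on a finite set $S$, the corresponding noisy voter model is the continuous time Markov chain $\{\eta_t\}_{t\ge0}$ on $\{0,1\}^S$ in which, independently, (1) for each two sites $x\ne y$, the state at $x$ changes to the value of the state at $y$ at rate $q(x,y)$, and (2) each site rerandomizes its state at rate 1 (its state is replaced by 0 or 1 with probability $1/2$ each, independently of everything else). Equivalently, when the configuration is $\eta$, independently at each $x\in S$, the state at $x$ changes $0\to1$ at rate $\frac12+\sum_{y\ne x}q(x,y)\eta(y)$ if $\eta(x)=0$, and $1\to0$ at rate $\frac12+\sum_{y\ne x}q(x,y)(1-\eta(y))$ if $\eta(x)=1$. This chain is irreducible and has a unique stationary distribution $\mu_\infty$; $\mu^\eta_t$ denotes the law of $\eta_t$ when $\eta_0=\eta$. Here $S$ is the vertex set of the $n$-star (center and leaves). Total variation distance: $\|m_1-m_2\|_{\mathtt{TV}}:=\frac12\sum_{s}|m_1(s)-m_2(s)|$. *)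

theory Defs
  imports "HOL-Probability.Probability"
begin

section \<open>Continuous time Markov chains on a finite state space\<close>

text \<open>
  A chain is given by a finite state space \<open>\<Omega>\<close> and jump rates \<open>r x y\<close> for \<open>x \<noteq> y\<close>; values
  \<open>r x x\<close> are ignored. Its law at time \<open>t\<close> is the row of \<open>exp (t Q)\<close> belonging to the initial
  state, where \<open>Q\<close> is the generator. The power series is written out because the library has no
  exponential for matrices indexed by a set.
\<close>

definition generator :: "'s set \<Rightarrow> ('s \<Rightarrow> 's \<Rightarrow> real) \<Rightarrow> 's \<Rightarrow> 's \<Rightarrow> real" where
  "generator \<Omega> r x y = (if x = y then - (\<Sum>z\<in>\<Omega> - {x}. r x z) else r x y)"

primrec matrix_power :: "'s set \<Rightarrow> ('s \<Rightarrow> 's \<Rightarrow> real) \<Rightarrow> nat \<Rightarrow> 's \<Rightarrow> 's \<Rightarrow> real" where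
  "matrix_power \<Omega> A 0 = (\<lambda>x y. if x = y then 1 else 0)"
| "matrix_power \<Omega> A (Suc k) = (\<lambda>x y. \<Sum>z\<in>\<Omega>. matrix_power \<Omega> A k x z * A z y)"

definition ctmc_law :: "'s set \<Rightarrow> ('s \<Rightarrow> 's \<Rightarrow> real) \<Rightarrow> 's \<Rightarrow> real \<Rightarrow> 's \<Rightarrow> real" where
  "ctmc_law \<Omega> r x t y = (\<Sum>k. t ^ k / fact k * matrix_power \<Omega> (generator \<Omega> r) k x y)"

definition is_stationary :: "'s set \<Rightarrow> ('s \<Rightarrow> 's \<Rightarrow> real) \<Rightarrow> 's pmf \<Rightarrow> bool" where
  "is_stationary \<Omega> r p \<longleftrightarrow> set_pmf p \<subseteq> \<Omega> \<and>
     (\<forall>t\<ge>0. \<forall>y\<in>\<Omega>. (\<Sum>x\<in>\<Omega>. pmf p x * ctmc_law \<Omega> r x t y) = pmf p y)"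

definition stationary_distribution :: "'s set \<Rightarrow> ('s \<Rightarrow> 's \<Rightarrow> real) \<Rightarrow> 's \<Rightarrow> real" where
  "stationary_distribution \<Omega> r = pmf (THE p. is_stationary \<Omega> r p)"

definition tv_dist :: "'s set \<Rightarrow> ('s \<Rightarrow> real) \<Rightarrow> ('s \<Rightarrow> real) \<Rightarrow> real" where
  "tv_dist \<Omega> m1 m2 = 1/2 * (\<Sum>s\<in>\<Omega>. \<bar>m1 s - m2 s\<bar>)"

section \<open>The noisy voter model\<close>

text \<open>
  Configurations are extensional functions, that is, \<open>undefined\<close> outside the site set \<open>S\<close>, so
  that they correspond exactly to the elements of \<open>{0,1}\<close> to the power \<open>S\<close>.
\<close>

definition configurations :: "'a set \<Rightarrow> ('a \<Rightarrow> nat) set" where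
  "configurations S = S \<rightarrow>\<^sub>E {0, 1}"

definition flip :: "('a \<Rightarrow> nat) \<Rightarrow> 'a \<Rightarrow> 'a \<Rightarrow> nat" where
  "flip \<eta> x = \<eta>(x := 1 - \<eta> x)"

text \<open>
  The rate at which site \<open>x\<close> changes its state in configuration \<open>\<eta>\<close>. The summand \<open>1/2\<close> comes
  from rerandomization, which happens at rate 1 and changes the state with probability \<open>1/2\<close>.
\<close>

definition flip_rate :: "'a set \<Rightarrow> ('a \<Rightarrow> 'a \<Rightarrow> real) \<Rightarrow> ('a \<Rightarrow> nat) \<Rightarrow> 'a \<Rightarrow> real" where
  "flip_rate S q \<eta> x =
     (if \<eta> x = 0 then 1/2 + (\<Sum>y\<in>S - {x}. q x y * real (\<eta> y))
      else 1/2 + (\<Sum>y\<in>S - {x}. q x y * (1 - real (\<eta> y))))"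

text \<open>
  Sites flip independently, so the chain jumps from \<open>\<eta>\<close> only to configurations differing from
  \<open>\<eta>\<close> at exactly one site; at most one summand below is nonzero.
\<close>

definition voter_rate :: "'a set \<Rightarrow> ('a \<Rightarrow> 'a \<Rightarrow> real) \<Rightarrow> ('a \<Rightarrow> nat) \<Rightarrow> ('a \<Rightarrow> nat) \<Rightarrow> real" where
  "voter_rate S q \<eta> \<xi> = (\<Sum>x\<in>S. if \<xi> = flip \<eta> x then flip_rate S q \<eta> x else 0)"

definition voter_law :: "'a set \<Rightarrow> ('a \<Rightarrow> 'a \<Rightarrow> real) \<Rightarrow> ('a \<Rightarrow> nat) \<Rightarrow> real \<Rightarrow> ('a \<Rightarrow> nat) \<Rightarrow> real" where
  "voter_law S q = ctmc_law (configurations S) (voter_rate S q)"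

definition voter_stationary :: "'a set \<Rightarrow> ('a \<Rightarrow> 'a \<Rightarrow> real) \<Rightarrow> ('a \<Rightarrow> nat) \<Rightarrow> real" where
  "voter_stationary S q = stationary_distribution (configurations S) (voter_rate S q)"

section \<open>Random walk on a graph and the star\<close>

definition walk_rate :: "'a set \<Rightarrow> ('a \<Rightarrow> 'a \<Rightarrow> bool) \<Rightarrow> 'a \<Rightarrow> 'a \<Rightarrow> real" where
  "walk_rate V adj x y = (if adj x y then 1 / real (card {z\<in>V. adj x z}) else 0)"

datatype star_vertex = Center | Leaf nat

definition leaves :: "nat \<Rightarrow> star_vertex set" where
  "leaves n = Leaf ` {..<n}"

definition star :: "nat \<Rightarrow> star_vertex set" where
  "star n = insert Center (leaves n)"

definition star_adj :: "nat \<Rightarrow> star_vertex \<Rightarrow> star_vertex \<Rightarrow> bool" where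
  "star_adj n x y \<longleftrightarrow> (x = Center \<and> y \<in> leaves n) \<or> (x \<in> leaves n \<and> y = Center)"

definition star_rate :: "nat \<Rightarrow> star_vertex \<Rightarrow> star_vertex \<Rightarrow> real" where
  "star_rate n = walk_rate (star n) (star_adj n)"

lemma star_rate_simps:
  shows "x \<in> leaves n \<Longrightarrow> star_rate n x Center = 1"
    and "x \<in> leaves n \<Longrightarrow> star_rate n Center x = 1 / real n"
    and "star_rate n Center Center = 0"
    and "x \<in> leaves n \<Longrightarrow> y \<in> leaves n \<Longrightarrow> star_rate n x y = 0"
proof -
  have c: "Center \<notin> leaves n" by (auto simp: leaves_def)
  have N: "{z \<in> star n. star_adj n Center z} = leaves n"
    using c by (auto simp: star_def star_adj_def)
  have L: "{z \<in> star n. star_adj n x z} = {Center}" if "x \<in> leaves n" for x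
    using c that by (auto simp: star_def star_adj_def)
  have card: "card (leaves n) = n"
    by (simp add: leaves_def card_image inj_on_def)
  show "x \<in> leaves n \<Longrightarrow> star_rate n x Center = 1"
    by (simp add: star_rate_def walk_rate_def L) (simp add: star_adj_def)
  show "x \<in> leaves n \<Longrightarrow> star_rate n Center x = 1 / real n"
    by (simp add: star_rate_def walk_rate_def N card) (simp add: star_adj_def)
  show "star_rate n Center Center = 0"
    using c by (simp add: star_rate_def walk_rate_def star_adj_def)
  show "x \<in> leaves n \<Longrightarrow> y \<in> leaves n \<Longrightarrow> star_rate n x y = 0"
    using c by (auto simp: star_rate_def walk_rate_def star_adj_def)
qed

definition star_voter_law :: "nat \<Rightarrow> (star_vertex \<Rightarrow> nat) \<Rightarrow> real \<Rightarrow> (star_vertex \<Rightarrow> nat) \<Rightarrow> real" where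
  "star_voter_law n = voter_law (star n) (star_rate n)"

definition star_voter_stationary :: "nat \<Rightarrow> (star_vertex \<Rightarrow> nat) \<Rightarrow> real" where
  "star_voter_stationary n = voter_stationary (star n) (star_rate n)"

definition all_ones :: "nat \<Rightarrow> star_vertex \<Rightarrow> nat" where
  "all_ones n = (\<lambda>x\<in>star n. 1)"

end

theory Submission imports Defs begin

text \<open>
  All estimates on the law of the chain come from one tool. If \<open>v\<close> depends smoothly on time,
  \<open>\<partial>\<^sub>t v \<le> L v\<close> for the generator \<open>L\<close>, and \<open>v \<le> f\<close> at time 0, then \<open>v\<close> stays below the
  expectation of \<open>f\<close> at time \<open>t\<close>; the same holds for supersolutions. This is a minimum principle
  (\<open>comparison_principle\<close>), and every bound below is obtained by exhibiting an explicit \<open>v\<close>.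

  Existence, uniqueness and attraction of the stationary distribution follow from Doeblin's
  condition (\<open>law_convergent_stationary\<close>). It holds because all transition probabilities at time
  1 are positive: the chain can correct the wrong sites one at a time (\<open>law_positive\<close>).

  Part (i). Take a sum \<open>f\<close> of the leaf states with signs \<open>\<plusminus>1\<close>, as many of each, where the signs are
  plus exactly on the leaves that carry a 1 initially. What the leaves copy from the center cancels
  in \<open>f\<close>, so \<open>L f = - 2 f\<close>, and \<open>L f\<^sup>2 \<le> - 4 f\<^sup>2 + 3 n / 2\<close>. Hence the mean of \<open>f\<close> is
  \<open>exp (- 2 t) n / 2\<close> at time \<open>t\<close> and 0 in equilibrium, while both variances are at most
  \<open>3 n / 8\<close>. Two laws whose means differ by \<open>M\<close> and whose variances are at most \<open>V\<close> are at distance at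
  least \<open>M\<^sup>2 / (4 V + M\<^sup>2)\<close> (\<open>tv_dist_ge_of_moments\<close>), which here is
  \<open>exp C / (6 + exp C)\<close> (\<open>tv_lower_bound\<close>).

  Part (ii). The law started from all ones and the stationary distribution are invariant under
  permutations of the leaves, so their distance is the distance of the laws of the pair (state of the
  center, number of ones). For this pair a Doeblin condition holds with constants that do not depend
  on \<open>n\<close>, for large \<open>n\<close>: from any configuration, after a fixed time, the center is 0 and there are exactly \<open>j\<close> ones
  with probability at least \<open>const / n\<close>, for every \<open>j\<close> between \<open>5 n / 16\<close> and \<open>7 n / 16\<close>
  (\<open>law_class_ge\<close>). The randomness that spreads the number of ones over a window of order
  \<open>n\<close> is a single flip of the center from 1 to 0 at a random time \<open>s\<close>. Given \<open>s\<close>, the leaves are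
  independent, with success probabilities that increase with \<open>s\<close>. Moving \<open>s\<close> raises
  the probability of at least \<open>j\<close> ones at a rate which is a sum over the leaves of the
  probabilities that the other leaves have exactly \<open>j - 1\<close> ones, and each of these is at most a
  constant times the probability of exactly \<open>j\<close> ones. Integrating over \<open>s\<close>, the probability of
  exactly \<open>j\<close> ones is therefore at least \<open>const / n\<close> times the total increase of the probability of
  at least \<open>j\<close> ones, and Chebyshev's inequality bounds this increase below by \<open>1/2\<close>, once \<open>n\<close> is large.
  In \<open>phase_lower_bound\<close> this argument takes the form of a subsolution.
  The finitely many remaining \<open>n\<close> are covered by convergence to equilibrium
  (\<open>mixing_from_all_ones_bounded\<close>).
\<close>

section \<open>The semigroup of a finite chain and its comparison principle\<close>

text \<open>
  The powers are defined by multiplication on the right; factoring on the left leads to the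
  backward equation.
\<close>

lemma matrix_power_Suc_left:
  assumes "finite \<Omega>" "x \<in> \<Omega>" "y \<in> \<Omega>"
  shows "matrix_power \<Omega> A (Suc k) x y = (\<Sum>z\<in>\<Omega>. A x z * matrix_power \<Omega> A k z y)"
  using assms(3)
proof (induction k arbitrary: y)
  case 0
  have "(\<Sum>z\<in>\<Omega>. (if x = z then 1 else 0) * A z y) = (\<Sum>z\<in>\<Omega>. if x = z then A z y else 0)"
    by (rule sum.cong) auto
  moreover have "(\<Sum>z\<in>\<Omega>. A x z * (if z = y then 1 else 0)) = (\<Sum>z\<in>\<Omega>. if z = y then A x z else 0)"
    by (rule sum.cong) auto
  ultimately show ?case
    using assms 0 by (simp add: sum.delta sum.delta')
next
  case (Suc k)
  have "matrix_power \<Omega> A (Suc (Suc k)) x y = (\<Sum>w\<in>\<Omega>. matrix_power \<Omega> A (Suc k) x w * A w y)"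
    by simp
  also have "\<dots> = (\<Sum>w\<in>\<Omega>. (\<Sum>z\<in>\<Omega>. A x z * matrix_power \<Omega> A k z w) * A w y)"
    using Suc.IH by (intro sum.cong) auto
  also have "\<dots> = (\<Sum>w\<in>\<Omega>. \<Sum>z\<in>\<Omega>. A x z * matrix_power \<Omega> A k z w * A w y)"
    by (simp add: sum_distrib_right)
  also have "\<dots> = (\<Sum>z\<in>\<Omega>. \<Sum>w\<in>\<Omega>. A x z * matrix_power \<Omega> A k z w * A w y)"
    by (rule sum.swap)
  also have "\<dots> = (\<Sum>z\<in>\<Omega>. A x z * matrix_power \<Omega> A (Suc k) z y)"
    by (simp add: sum_distrib_left mult.assoc)
  finally show ?case .
qed

lemma matrix_power_bounded:
  assumes "finite \<Omega>"
  obtains M :: real where "0 \<le> M"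
    "\<And>k x y. x \<in> \<Omega> \<Longrightarrow> y \<in> \<Omega> \<Longrightarrow> \<bar>matrix_power \<Omega> A k x y\<bar> \<le> M ^ k"
proof -
  define M where "M = (\<Sum>z\<in>\<Omega>. \<Sum>y\<in>\<Omega>. \<bar>A z y\<bar>)"
  have M0: "0 \<le> M" by (simp add: M_def sum_nonneg)
  have "\<bar>matrix_power \<Omega> A k x y\<bar> \<le> M ^ k" if "x \<in> \<Omega>" "y \<in> \<Omega>" for k x y
    using that(2)
  proof (induction k arbitrary: y)
    case 0
    then show ?case by simp
  next
    case (Suc k)
    have "\<bar>matrix_power \<Omega> A (Suc k) x y\<bar> \<le> (\<Sum>z\<in>\<Omega>. \<bar>matrix_power \<Omega> A k x z * A z y\<bar>)"
      by (simp add: sum_abs)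
    also have "\<dots> \<le> (\<Sum>z\<in>\<Omega>. M ^ k * \<bar>A z y\<bar>)"
      using Suc.IH by (intro sum_mono) (simp add: abs_mult mult_right_mono)
    also have "\<dots> = M ^ k * (\<Sum>z\<in>\<Omega>. \<bar>A z y\<bar>)" by (simp add: sum_distrib_left)
    also have "\<dots> \<le> M ^ k * M"
    proof (rule mult_left_mono)
      show "(\<Sum>z\<in>\<Omega>. \<bar>A z y\<bar>) \<le> M" unfolding M_def
        using Suc.prems assms by (intro sum_mono member_le_sum) auto
    qed (simp add: M0)
    finally show ?case by (simp add: mult.commute)
  qed
  with M0 show ?thesis by (rule that)
qed

locale finite_chain =
  fixes \<Omega> :: "'s set" and r :: "'s \<Rightarrow> 's \<Rightarrow> real"
  assumes finite_states: "finite \<Omega>"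
    and rate_nonneg: "x \<in> \<Omega> \<Longrightarrow> y \<in> \<Omega> \<Longrightarrow> x \<noteq> y \<Longrightarrow> 0 \<le> r x y"
begin

abbreviation "P t x y \<equiv> ctmc_law \<Omega> r x t y"

text \<open>
  The generator acting on functions; the difference form makes the minimum principle visible.
\<close>

definition gen :: "('s \<Rightarrow> real) \<Rightarrow> 's \<Rightarrow> real" where
  "gen f x = (\<Sum>y\<in>\<Omega> - {x}. r x y * (f y - f x))"

definition expect :: "real \<Rightarrow> ('s \<Rightarrow> real) \<Rightarrow> 's \<Rightarrow> real" where
  "expect t f x = (\<Sum>y\<in>\<Omega>. P t x y * f y)"

lemma generator_apply:
  assumes "x \<in> \<Omega>"
  shows "(\<Sum>y\<in>\<Omega>. generator \<Omega> r x y * f y) = gen f x"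
proof -
  have "(\<Sum>y\<in>\<Omega>. generator \<Omega> r x y * f y)
      = generator \<Omega> r x x * f x + (\<Sum>y\<in>\<Omega> - {x}. generator \<Omega> r x y * f y)"
    using assms finite_states by (simp add: sum.remove)
  also have "(\<Sum>y\<in>\<Omega> - {x}. generator \<Omega> r x y * f y) = (\<Sum>y\<in>\<Omega> - {x}. r x y * f y)"
    by (rule sum.cong) (auto simp: generator_def)
  finally show ?thesis
    by (simp add: gen_def generator_def algebra_simps sum_subtractf sum_distrib_left)
qed

lemma gen_add: "gen (\<lambda>x. f x + g x) x = gen f x + gen g x"
  by (simp add: gen_def algebra_simps sum.distrib sum_subtractf)

lemma gen_diff: "gen (\<lambda>x. f x - g x) x = gen f x - gen g x"
  by (simp add: gen_def algebra_simps sum.distrib sum_subtractf)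

lemma gen_mult: "gen (\<lambda>x. c * f x) x = c * gen f x"
  by (simp add: gen_def algebra_simps sum_distrib_left sum_subtractf)

lemma gen_const: "gen (\<lambda>x. c) x = 0"
  by (simp add: gen_def)

lemma summable_law_series:
  assumes "x \<in> \<Omega>" "y \<in> \<Omega>"
  shows "summable (\<lambda>k. matrix_power \<Omega> (generator \<Omega> r) k x y / fact k * t ^ k)"
proof -
  obtain M where M: "0 \<le> M"
    "\<And>k x y. x \<in> \<Omega> \<Longrightarrow> y \<in> \<Omega> \<Longrightarrow> \<bar>matrix_power \<Omega> (generator \<Omega> r) k x y\<bar> \<le> M ^ k"
    using matrix_power_bounded[OF finite_states] by metis
  show ?thesis
  proof (rule summable_comparison_test')
    show "summable (\<lambda>k. inverse (fact k) * (M * \<bar>t\<bar>) ^ k)"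
      by (rule summable_exp)
    show "norm (matrix_power \<Omega> (generator \<Omega> r) k x y / fact k * t ^ k)
        \<le> inverse (fact k) * (M * \<bar>t\<bar>) ^ k" if "k \<ge> 0" for k
      using M(2)[OF assms, of k]
      by (simp add: abs_mult power_mult_distrib power_abs divide_simps mult_right_mono)
  qed
qed

lemma law_series: "P t x y = (\<Sum>k. matrix_power \<Omega> (generator \<Omega> r) k x y / fact k * t ^ k)"
  unfolding ctmc_law_def by (simp add: field_simps)

lemma law_0:
  assumes "x \<in> \<Omega>" "y \<in> \<Omega>"
  shows "P 0 x y = (if x = y then 1 else 0)"
  unfolding law_series by (subst suminf_finite[where N = "{0}"]) auto

lemma expect_0: "x \<in> \<Omega> \<Longrightarrow> expect 0 f x = f x"
proof -
  assume x: "x \<in> \<Omega>"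
  have "expect 0 f x = (\<Sum>y\<in>\<Omega>. if x = y then f y else 0)"
    unfolding expect_def using x by (intro sum.cong) (auto simp: law_0)
  then show ?thesis using x finite_states by simp
qed

text \<open>
  Kolmogorov's backward equation, by termwise differentiation of the exponential series.
\<close>

lemma law_has_derivative:
  assumes "x \<in> \<Omega>" "y \<in> \<Omega>"
  shows "((\<lambda>t. P t x y) has_real_derivative gen (\<lambda>z. P t z y) x) (at t)"
proof -
  let ?Q = "generator \<Omega> r"
  let ?c = "\<lambda>x k. matrix_power \<Omega> ?Q k x y / fact k"
  have "((\<lambda>t. \<Sum>k. ?c x k * t ^ k) has_real_derivative (\<Sum>k. diffs (?c x) k * t ^ k)) (at t)"
    by (rule termdiffs_strong_converges_everywhere) (rule summable_law_series[OF assms])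
  also have "(\<Sum>k. diffs (?c x) k * t ^ k) = (\<Sum>k. \<Sum>z\<in>\<Omega>. ?Q x z * (?c z k * t ^ k))"
  proof (rule suminf_cong)
    fix k
    have "diffs (?c x) k = matrix_power \<Omega> ?Q (Suc k) x y / fact k"
      by (simp add: diffs_def divide_simps)
    also have "\<dots> = (\<Sum>z\<in>\<Omega>. ?Q x z * ?c z k)"
      by (subst matrix_power_Suc_left[OF finite_states assms]) (simp add: sum_divide_distrib)
    finally show "diffs (?c x) k * t ^ k = (\<Sum>z\<in>\<Omega>. ?Q x z * (?c z k * t ^ k))"
      by (simp add: sum_distrib_right mult.assoc)
  qed
  also have "\<dots> = (\<Sum>z\<in>\<Omega>. \<Sum>k. ?Q x z * (?c z k * t ^ k))"
    using assms by (intro suminf_sum summable_mult summable_law_series) auto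
  also have "\<dots> = (\<Sum>z\<in>\<Omega>. ?Q x z * P t z y)"
    unfolding law_series using assms by (intro sum.cong suminf_mult summable_law_series) auto
  also have "\<dots> = gen (\<lambda>z. P t z y) x" by (rule generator_apply[OF assms(1)])
  finally show ?thesis unfolding law_series .
qed

lemma expect_has_derivative:
  assumes "x \<in> \<Omega>"
  shows "((\<lambda>t. expect t f x) has_real_derivative gen (expect t f) x) (at t)"
proof -
  have "((\<lambda>t. \<Sum>y\<in>\<Omega>. P t x y * f y) has_real_derivative
      (\<Sum>y\<in>\<Omega>. gen (\<lambda>z. P t z y) x * f y)) (at t)"
    by (intro DERIV_sum DERIV_cmult_right law_has_derivative assms)
  moreover have "(\<Sum>y\<in>\<Omega>. gen (\<lambda>z. P t z y) x * f y) = gen (expect t f) x"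
    unfolding gen_def expect_def sum_distrib_right sum_distrib_left sum_subtractf[symmetric]
    by (subst sum.swap) (simp add: algebra_simps)
  ultimately show ?thesis by (simp add: expect_def)
qed

text \<open>
  Add \<open>\<epsilon> t\<close> to make the inequality strict. If the result were negative somewhere,
  consider its minimum over \<open>[0,T] \<times> \<Omega>\<close>: the generator is nonnegative at the minimizing state, so
  the time derivative is positive there, and a slightly earlier time gives a smaller value.
\<close>

lemma comparison_principle:
  assumes deriv: "\<And>t x. 0 \<le> t \<Longrightarrow> x \<in> \<Omega> \<Longrightarrow> ((\<lambda>t. w t x) has_real_derivative w' t x) (at t)"
    and super: "\<And>t x. 0 \<le> t \<Longrightarrow> x \<in> \<Omega> \<Longrightarrow> gen (w t) x \<le> w' t x"
    and init: "\<And>x. x \<in> \<Omega> \<Longrightarrow> 0 \<le> w 0 x"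
    and "0 \<le> T" "x \<in> \<Omega>"
  shows "0 \<le> w T x"
proof (rule ccontr)
  assume neg: "\<not> 0 \<le> w T x"
  \<comment> \<open>small enough that \<open>w + \<epsilon> t\<close> is still negative at \<open>(T, x)\<close>\<close>
  define \<epsilon> where "\<epsilon> = - w T x / (2 * (T + 1))"
  have \<epsilon>: "0 < \<epsilon>" "w T x + \<epsilon> * T < 0"
  proof -
    show "0 < \<epsilon>" using neg \<open>0 \<le> T\<close> unfolding \<epsilon>_def by (intro divide_pos_pos) auto
    have "\<epsilon> * T \<le> \<epsilon> * (T + 1)" using \<open>0 < \<epsilon>\<close> by (intro mult_left_mono) auto
    also have "\<dots> = - w T x / 2" using \<open>0 \<le> T\<close> by (simp add: \<epsilon>_def field_simps)
    finally show "w T x + \<epsilon> * T < 0" using neg by linarith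
  qed
  define \<phi> where "\<phi> = (\<lambda>t x. w t x + \<epsilon> * t)"
  have \<phi>_deriv: "((\<lambda>t. \<phi> t x) has_real_derivative w' t x + \<epsilon>) (at t)" if "0 \<le> t" "x \<in> \<Omega>" for t x
    unfolding \<phi>_def by (auto intro!: derivative_eq_intros deriv that)
  have "\<exists>s\<in>{0..T}. \<forall>t\<in>{0..T}. \<phi> s x \<le> \<phi> t x" if "x \<in> \<Omega>" for x
    using \<open>0 \<le> T\<close>
    by (intro continuous_attains_inf)
      (auto intro!: continuous_at_imp_continuous_on DERIV_isCont \<phi>_deriv that)
  then obtain s where s: "\<And>x. x \<in> \<Omega> \<Longrightarrow> s x \<in> {0..T}"
    "\<And>x t. x \<in> \<Omega> \<Longrightarrow> t \<in> {0..T} \<Longrightarrow> \<phi> (s x) x \<le> \<phi> t x"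
    by metis
  obtain z where z: "z \<in> \<Omega>" "\<And>y. y \<in> \<Omega> \<Longrightarrow> \<phi> (s z) z \<le> \<phi> (s y) y"
  proof -
    have "\<exists>z. is_arg_min (\<lambda>y. \<phi> (s y) y) (\<lambda>y. y \<in> \<Omega>) z"
      using ex_is_arg_min_if_finite[OF finite_states] \<open>x \<in> \<Omega>\<close> by blast
    then show ?thesis using that by (auto simp: is_arg_min_linorder)
  qed
  have min: "\<phi> (s z) z \<le> \<phi> t y" if "t \<in> {0..T}" "y \<in> \<Omega>" for t y
    using z(2)[OF that(2)] s(2)[OF that(2,1)] by linarith
  have "\<phi> (s z) z < 0"
    using min[of T x] \<epsilon>(2) \<open>0 \<le> T\<close> \<open>x \<in> \<Omega>\<close> by (simp add: \<phi>_def)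
  then have "s z \<noteq> 0" using init[OF z(1)] by (auto simp: \<phi>_def)
  then have pos: "0 < s z" "s z \<le> T" using s(1)[OF z(1)] by auto
  have "0 \<le> gen (w (s z)) z"
    unfolding gen_def
  proof (intro sum_nonneg mult_nonneg_nonneg)
    fix y assume "y \<in> \<Omega> - {z}"
    then show "0 \<le> r z y" "0 \<le> w (s z) y - w (s z) z"
      using rate_nonneg z(1) min[of "s z" y] s(1)[OF z(1)] by (auto simp: \<phi>_def)
  qed
  then have "0 < w' (s z) z + \<epsilon>" using super[of "s z" z] pos z(1) \<epsilon>(1) by auto
  from DERIV_pos_inc_left[OF \<phi>_deriv this] pos z(1) obtain d where d: "0 < d"
    "\<And>h. 0 < h \<Longrightarrow> h < d \<Longrightarrow> \<phi> (s z - h) z < \<phi> (s z) z" by auto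
  define h where "h = min (d / 2) (s z)"
  have "\<phi> (s z - h) z < \<phi> (s z) z" using d pos by (auto simp: h_def)
  moreover have "s z - h \<in> {0..T}" using pos d by (auto simp: h_def)
  ultimately show False using min[of "s z - h" z] z(1) by simp
qed

lemma subsolution_le_expect:
  assumes deriv: "\<And>t x. 0 \<le> t \<Longrightarrow> x \<in> \<Omega> \<Longrightarrow> ((\<lambda>t. v t x) has_real_derivative v' t x) (at t)"
    and sub: "\<And>t x. 0 \<le> t \<Longrightarrow> x \<in> \<Omega> \<Longrightarrow> v' t x \<le> gen (v t) x"
    and init: "\<And>x. x \<in> \<Omega> \<Longrightarrow> v 0 x \<le> f x"
    and "0 \<le> t" "x \<in> \<Omega>"
  shows "v t x \<le> expect t f x"
proof -
  have "0 \<le> expect t f x - v t x"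
    by (rule comparison_principle[where w' = "\<lambda>t x. gen (expect t f) x - v' t x"])
      (auto intro!: DERIV_diff expect_has_derivative deriv
         simp: gen_diff expect_0 init sub assms(4,5))
  then show ?thesis by simp
qed

lemma expect_le_supersolution:
  assumes deriv: "\<And>t x. 0 \<le> t \<Longrightarrow> x \<in> \<Omega> \<Longrightarrow> ((\<lambda>t. v t x) has_real_derivative v' t x) (at t)"
    and super: "\<And>t x. 0 \<le> t \<Longrightarrow> x \<in> \<Omega> \<Longrightarrow> gen (v t) x \<le> v' t x"
    and init: "\<And>x. x \<in> \<Omega> \<Longrightarrow> f x \<le> v 0 x"
    and "0 \<le> t" "x \<in> \<Omega>"
  shows "expect t f x \<le> v t x"
proof -
  have "0 \<le> v t x - expect t f x"
    by (rule comparison_principle[where w' = "\<lambda>t x. v' t x - gen (expect t f) x"])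
      (auto intro!: DERIV_diff expect_has_derivative deriv
         simp: gen_diff expect_0 init super assms(4,5))
  then show ?thesis by simp
qed

lemma expect_unique:
  assumes deriv: "\<And>t x. 0 \<le> t \<Longrightarrow> x \<in> \<Omega> \<Longrightarrow> ((\<lambda>t. v t x) has_real_derivative gen (v t) x) (at t)"
    and init: "\<And>x. x \<in> \<Omega> \<Longrightarrow> v 0 x = f x"
    and "0 \<le> t" "x \<in> \<Omega>"
  shows "expect t f x = v t x"
  by (intro antisym expect_le_supersolution[OF deriv] subsolution_le_expect[OF deriv])
    (use assms in auto)

text \<open>
  Transition probabilities are expectations of indicators, so the comparison principle applies to them.
\<close>

lemma law_eq_expect:
  assumes "x \<in> \<Omega>" "y \<in> \<Omega>"
  shows "P t x y = expect t (\<lambda>z. if z = y then 1 else 0) x"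
proof -
  have "expect t (\<lambda>z. if z = y then 1 else 0) x = (\<Sum>z\<in>\<Omega>. if z = y then P t x z else 0)"
    unfolding expect_def by (rule sum.cong) auto
  then show ?thesis using assms finite_states by simp
qed

lemma law_nonneg:
  assumes "0 \<le> t" "x \<in> \<Omega>" "y \<in> \<Omega>"
  shows "0 \<le> P t x y"
  unfolding law_eq_expect[OF assms(2,3)]
  by (rule subsolution_le_expect[where v' = "\<lambda>_ _. 0"]) (auto simp: gen_const assms)

lemma expect_mono:
  assumes "\<And>x. x \<in> \<Omega> \<Longrightarrow> f x \<le> g x" "0 \<le> t" "x \<in> \<Omega>"
  shows "expect t f x \<le> expect t g x"
  unfolding expect_def by (intro sum_mono mult_left_mono law_nonneg assms)

lemma law_sum:
  assumes "0 \<le> t" "x \<in> \<Omega>"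
  shows "(\<Sum>y\<in>\<Omega>. P t x y) = 1"
proof -
  have "expect t (\<lambda>_. 1) x = 1"
    by (rule expect_unique) (auto simp: gen_const assms)
  then show ?thesis by (simp add: expect_def)
qed

text \<open>
  Both sides solve the backward equation in \<open>s\<close> with the same initial value.
\<close>

lemma expect_add:
  assumes "0 \<le> s" "0 \<le> t" "x \<in> \<Omega>"
  shows "expect (s + t) f x = expect s (expect t f) x"
proof -
  have "expect s (expect t f) x = expect (s + t) f x"
  proof (rule expect_unique)
    fix u x assume "0 \<le> (u::real)" "x \<in> \<Omega>"
    have "((\<lambda>u. expect u f x) has_real_derivative gen (expect (u + t) f) x) (at (u + t))"
      by (rule expect_has_derivative) fact
    then show "((\<lambda>u. expect (u + t) f x) has_real_derivative gen (expect (u + t) f) x) (at u)"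
      by (simp add: DERIV_shift)
  qed (use assms in auto)
  then show ?thesis ..
qed

lemma law_add:
  assumes "0 \<le> s" "0 \<le> t" "x \<in> \<Omega>" "y \<in> \<Omega>"
  shows "P (s + t) x y = (\<Sum>z\<in>\<Omega>. P s x z * P t z y)"
proof -
  have "P (s + t) x y = expect s (expect t (\<lambda>z. if z = y then 1 else 0)) x"
    using expect_add[OF assms(1-3)] law_eq_expect assms by simp
  also have "\<dots> = (\<Sum>z\<in>\<Omega>. P s x z * P t z y)"
    unfolding expect_def[of s] using assms(4) by (intro sum.cong) (auto simp: law_eq_expect)
  finally show ?thesis .
qed

end

section \<open>Contraction under a Doeblin condition\<close>

text \<open>
  As \<open>v\<close> has total mass 0, the common part \<open>\<omega>\<close> of all rows can be subtracted from \<open>K\<close> without changing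
  \<open>v K\<close>, and the rows of the remaining kernel have mass \<open>1 - \<Sum>\<omega>\<close>. The target space may differ from
  the source, so that the kernel may be followed by a projection.
\<close>

lemma doeblin_contraction:
  fixes K :: "'s \<Rightarrow> 'u \<Rightarrow> real"
  assumes minor: "\<And>x y. x \<in> \<Omega> \<Longrightarrow> y \<in> Y \<Longrightarrow> \<omega> y \<le> K x y"
    and stoch: "\<And>x. x \<in> \<Omega> \<Longrightarrow> (\<Sum>y\<in>Y. K x y) = 1"
    and mass: "(\<Sum>x\<in>\<Omega>. v x) = 0"
  shows "(\<Sum>y\<in>Y. \<bar>\<Sum>x\<in>\<Omega>. v x * K x y\<bar>) \<le> (1 - (\<Sum>y\<in>Y. \<omega> y)) * (\<Sum>x\<in>\<Omega>. \<bar>v x\<bar>)"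
proof -
  have "(\<Sum>y\<in>Y. \<bar>\<Sum>x\<in>\<Omega>. v x * K x y\<bar>) \<le> (\<Sum>y\<in>Y. \<Sum>x\<in>\<Omega>. \<bar>v x\<bar> * (K x y - \<omega> y))"
  proof (rule sum_mono)
    fix y assume y: "y \<in> Y"
    have "(\<Sum>x\<in>\<Omega>. v x * K x y) = (\<Sum>x\<in>\<Omega>. v x * (K x y - \<omega> y))"
      using mass by (simp add: right_diff_distrib sum_subtractf sum_distrib_right[symmetric])
    also have "\<bar>\<dots>\<bar> \<le> (\<Sum>x\<in>\<Omega>. \<bar>v x * (K x y - \<omega> y)\<bar>)" by (rule sum_abs)
    also have "\<dots> = (\<Sum>x\<in>\<Omega>. \<bar>v x\<bar> * (K x y - \<omega> y))"
      using minor y by (intro sum.cong) (auto simp: abs_mult)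
    finally show "\<bar>\<Sum>x\<in>\<Omega>. v x * K x y\<bar> \<le> (\<Sum>x\<in>\<Omega>. \<bar>v x\<bar> * (K x y - \<omega> y))" .
  qed
  also have "\<dots> = (\<Sum>x\<in>\<Omega>. \<bar>v x\<bar> * (\<Sum>y\<in>Y. K x y - \<omega> y))"
    by (subst sum.swap) (simp add: sum_distrib_left)
  also have "\<dots> = (\<Sum>x\<in>\<Omega>. \<bar>v x\<bar> * (1 - (\<Sum>y\<in>Y. \<omega> y)))"
    using stoch by (intro sum.cong) (auto simp: sum_subtractf)
  finally show ?thesis by (simp add: sum_distrib_left mult.commute)
qed

lemma geometric_differences_converge:
  fixes a :: "nat \<Rightarrow> real"
  assumes "\<And>m. \<bar>a (Suc m) - a m\<bar> \<le> c * q ^ m" "0 \<le> q" "q < 1"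
  shows "convergent a"
proof -
  have "summable (\<lambda>m. a (Suc m) - a m)"
    by (rule summable_comparison_test'[of "\<lambda>m. c * q ^ m" 0])
      (use assms in \<open>auto intro!: summable_mult summable_geometric\<close>)
  then have "convergent (\<lambda>m. \<Sum>k<m. a (Suc k) - a k)" by (simp add: summable_iff_convergent)
  then have "convergent (\<lambda>m. a m - a 0)" by (simp add: sum_lessThan_telescope)
  then have "convergent (\<lambda>m. (a m - a 0) + a 0)" by (intro convergent_add convergent_const)
  then show ?thesis by simp
qed

text \<open>
  Doeblin's theorem. The kernel at time \<open>T\<close> contracts measures of mass 0, so the laws at the multiples
  of \<open>T\<close> form a Cauchy sequence whose limit does not depend on the start. This limit is the only law
  invariant under the kernel at time \<open>T\<close>, and it is then invariant at all times.
\<close>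

lemma (in finite_chain) law_convergent_stationary:
  assumes minor: "\<And>x. x \<in> \<Omega> \<Longrightarrow> \<epsilon> \<le> P T x y" and "0 < \<epsilon>" "0 \<le> T" and y: "y \<in> \<Omega>"
  defines "\<pi> \<equiv> stationary_distribution \<Omega> r"
  shows "x \<in> \<Omega> \<Longrightarrow> 0 \<le> \<pi> x"
    and "(\<Sum>x\<in>\<Omega>. \<pi> x) = 1"
    and "0 \<le> t \<Longrightarrow> z \<in> \<Omega> \<Longrightarrow> (\<Sum>x\<in>\<Omega>. \<pi> x * P t x z) = \<pi> z"
    and "x \<in> \<Omega> \<Longrightarrow> z \<in> \<Omega> \<Longrightarrow> (\<lambda>m. P (real m * T) x z) \<longlonglongrightarrow> \<pi> z"
proof -
  define q where "q = 1 - \<epsilon>"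
  define \<omega> where "\<omega> z = (if z = y then \<epsilon> else 0)" for z
  have q: "0 \<le> q" "q < 1"
  proof -
    have "\<epsilon> \<le> P T y y" by (rule minor[OF y])
    also have "\<dots> \<le> (\<Sum>z\<in>\<Omega>. P T y z)"
      using y finite_states law_nonneg[OF \<open>0 \<le> T\<close> y] by (intro member_le_sum) auto
    also have "\<dots> = 1" using law_sum[OF \<open>0 \<le> T\<close> y] .
    finally show "0 \<le> q" by (simp add: q_def)
    show "q < 1" using \<open>0 < \<epsilon>\<close> by (simp add: q_def)
  qed
  have contract: "(\<Sum>z\<in>\<Omega>. \<bar>\<Sum>x\<in>\<Omega>. v x * P T x z\<bar>) \<le> q * (\<Sum>x\<in>\<Omega>. \<bar>v x\<bar>)"
    if "(\<Sum>x\<in>\<Omega>. v x) = 0" for v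
  proof -
    have "(\<Sum>z\<in>\<Omega>. \<omega> z) = \<epsilon>" using y finite_states by (simp add: \<omega>_def)
    then show ?thesis
      using doeblin_contraction[of \<Omega> \<Omega> \<omega> "P T" v] minor law_nonneg[OF \<open>0 \<le> T\<close>]
        law_sum[OF \<open>0 \<le> T\<close>] that by (auto simp: \<omega>_def q_def)
  qed
  have unique: "v z = 0"
    if v: "(\<Sum>x\<in>\<Omega>. v x) = 0" "\<And>z. z \<in> \<Omega> \<Longrightarrow> (\<Sum>x\<in>\<Omega>. v x * P T x z) = v z" and z: "z \<in> \<Omega>" for v z
  proof -
    have "(\<Sum>z\<in>\<Omega>. \<bar>v z\<bar>) \<le> q * (\<Sum>x\<in>\<Omega>. \<bar>v x\<bar>)"
      using contract[OF v(1)] v(2) by simp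
    then have "(1 - q) * (\<Sum>z\<in>\<Omega>. \<bar>v z\<bar>) \<le> 0" by (simp add: algebra_simps)
    then have "(\<Sum>z\<in>\<Omega>. \<bar>v z\<bar>) \<le> 0" using q by (simp add: mult_le_0_iff)
    moreover have "\<bar>v z\<bar> \<le> (\<Sum>z\<in>\<Omega>. \<bar>v z\<bar>)"
      using z finite_states by (intro member_le_sum) auto
    ultimately show "v z = 0" by linarith
  qed
  have law_Suc: "P (real (Suc m) * T) x z = (\<Sum>w\<in>\<Omega>. P (real m * T) x w * P T w z)"
    if "x \<in> \<Omega>" "z \<in> \<Omega>" for m x z
    using law_add[of "real m * T" T x z] that \<open>0 \<le> T\<close> by (simp add: algebra_simps)
  have diffs: "(\<Sum>z\<in>\<Omega>. \<bar>P (real (Suc m) * T) x z - P (real m * T) x' z\<bar>)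
      \<le> q ^ m * (\<Sum>z\<in>\<Omega>. \<bar>P T x z - P 0 x' z\<bar>)" if "x \<in> \<Omega>" "x' \<in> \<Omega>" for m x x'
  proof (induction m)
    case (Suc m)
    define v where "v = (\<lambda>z. P (real (Suc m) * T) x z - P (real m * T) x' z)"
    have "(\<Sum>z\<in>\<Omega>. \<bar>P (real (Suc (Suc m)) * T) x z - P (real (Suc m) * T) x' z\<bar>)
        = (\<Sum>z\<in>\<Omega>. \<bar>\<Sum>w\<in>\<Omega>. v w * P T w z\<bar>)"
      using that by (intro sum.cong)
        (auto simp: law_Suc v_def left_diff_distrib sum_subtractf simp del: of_nat_Suc)
    also have "\<dots> \<le> q * (\<Sum>z\<in>\<Omega>. \<bar>v z\<bar>)"
      using that \<open>0 \<le> T\<close> by (intro contract)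
        (simp add: v_def sum_subtractf law_sum del: of_nat_Suc)
    also have "\<dots> \<le> q * (q ^ m * (\<Sum>z\<in>\<Omega>. \<bar>P T x z - P 0 x' z\<bar>))"
      using Suc q by (intro mult_left_mono) (auto simp: v_def)
    finally show ?case by simp
  qed simp
  \<comment> \<open>\<open>diffs\<close> with \<open>x = x'\<close> shows convergence, and with \<open>x \<noteq> x'\<close> that the limit
    does not depend on the start\<close>
  define \<rho> where "\<rho> z = lim (\<lambda>m. P (real m * T) y z)" for z
  have coord: "\<bar>P (real (Suc m) * T) x z - P (real m * T) x' z\<bar>
      \<le> (\<Sum>z\<in>\<Omega>. \<bar>P T x z - P 0 x' z\<bar>) * q ^ m" if "x \<in> \<Omega>" "x' \<in> \<Omega>" "z \<in> \<Omega>" for m x x' z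
    using order_trans[OF member_le_sum diffs[of x x' m], of z] that finite_states
    by (simp add: mult.commute)
  have conv_y: "(\<lambda>m. P (real m * T) y z) \<longlonglongrightarrow> \<rho> z" if "z \<in> \<Omega>" for z
    using geometric_differences_converge[OF coord[OF y y that] q]
    by (simp add: \<rho>_def convergent_LIMSEQ_iff)
  have conv: "(\<lambda>m. P (real m * T) x z) \<longlonglongrightarrow> \<rho> z" if "x \<in> \<Omega>" "z \<in> \<Omega>" for x z
  proof -
    have "(\<lambda>m. P (real (Suc m) * T) x z - P (real m * T) y z) \<longlonglongrightarrow> 0"
    proof (rule Lim_null_comparison)
      show "(\<lambda>m. (\<Sum>z\<in>\<Omega>. \<bar>P T x z - P 0 y z\<bar>) * q ^ m) \<longlonglongrightarrow> 0"
        using q by (intro tendsto_mult_right_zero LIMSEQ_power_zero) auto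
    qed (use coord that y in auto)
    from tendsto_add[OF this conv_y[OF that(2)]]
    have "(\<lambda>m. P (real (Suc m) * T) x z) \<longlonglongrightarrow> \<rho> z" by simp
    then show ?thesis by (rule filterlim_sequentially_Suc[THEN iffD1])
  qed
  have \<rho>_nonneg: "0 \<le> \<rho> z" if "z \<in> \<Omega>" for z
    by (rule LIMSEQ_le_const[OF conv_y[OF that]]) (use law_nonneg \<open>0 \<le> T\<close> y that in auto)
  have \<rho>_sum: "(\<Sum>z\<in>\<Omega>. \<rho> z) = 1"
  proof (rule LIMSEQ_unique)
    show "(\<lambda>m. \<Sum>z\<in>\<Omega>. P (real m * T) y z) \<longlonglongrightarrow> (\<Sum>z\<in>\<Omega>. \<rho> z)"
      by (intro tendsto_sum conv_y)
    show "(\<lambda>m. \<Sum>z\<in>\<Omega>. P (real m * T) y z) \<longlonglongrightarrow> 1"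
      using law_sum \<open>0 \<le> T\<close> y by simp
  qed
  have \<rho>_T: "(\<Sum>x\<in>\<Omega>. \<rho> x * P T x z) = \<rho> z" if "z \<in> \<Omega>" for z
  proof (rule LIMSEQ_unique)
    show "(\<lambda>m. P (real (Suc m) * T) y z) \<longlonglongrightarrow> (\<Sum>x\<in>\<Omega>. \<rho> x * P T x z)"
      unfolding law_Suc[OF y that] by (intro tendsto_intros conv_y)
    show "(\<lambda>m. P (real (Suc m) * T) y z) \<longlonglongrightarrow> \<rho> z"
      using conv_y[OF that] by (rule filterlim_sequentially_Suc[THEN iffD2])
  qed
  \<comment> \<open>\<open>\<rho> P\<^sub>t\<close> is again invariant under \<open>P\<^sub>T\<close>, hence equal to \<open>\<rho>\<close>\<close>
  have \<rho>_t: "(\<Sum>x\<in>\<Omega>. \<rho> x * P t x z) = \<rho> z" if "0 \<le> t" "z \<in> \<Omega>" for t z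
  proof -
    define v where "v z = (\<Sum>x\<in>\<Omega>. \<rho> x * P t x z) - \<rho> z" for z
    have "(\<Sum>z\<in>\<Omega>. \<Sum>x\<in>\<Omega>. \<rho> x * P t x z) = (\<Sum>x\<in>\<Omega>. \<rho> x * (\<Sum>z\<in>\<Omega>. P t x z))"
      by (subst sum.swap) (simp add: sum_distrib_left)
    also have "\<dots> = 1" using \<rho>_sum law_sum[OF \<open>0 \<le> t\<close>] by simp
    finally have "(\<Sum>z\<in>\<Omega>. v z) = 0" by (simp add: v_def sum_subtractf \<rho>_sum)
    moreover have "(\<Sum>w\<in>\<Omega>. v w * P T w z) = v z" if "z \<in> \<Omega>" for z
    proof -
      have "(\<Sum>w\<in>\<Omega>. (\<Sum>x\<in>\<Omega>. \<rho> x * P t x w) * P T w z)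
          = (\<Sum>x\<in>\<Omega>. \<rho> x * (\<Sum>w\<in>\<Omega>. P t x w * P T w z))"
        unfolding sum_distrib_left sum_distrib_right by (subst sum.swap) (simp add: mult.assoc)
      also have "\<dots> = (\<Sum>x\<in>\<Omega>. \<rho> x * (\<Sum>w\<in>\<Omega>. P T x w * P t w z))"
        using law_add[of t T _ z] law_add[of T t _ z] \<open>0 \<le> t\<close> \<open>0 \<le> T\<close> that
        by (intro sum.cong) (auto simp: add.commute)
      also have "\<dots> = (\<Sum>w\<in>\<Omega>. (\<Sum>x\<in>\<Omega>. \<rho> x * P T x w) * P t w z)"
        unfolding sum_distrib_left sum_distrib_right by (subst sum.swap) (simp add: mult.assoc)
      also have "\<dots> = (\<Sum>x\<in>\<Omega>. \<rho> x * P t x z)"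
        by (intro sum.cong) (auto simp: \<rho>_T)
      finally show ?thesis
        by (simp add: v_def left_diff_distrib sum_subtractf \<rho>_T that)
    qed
    ultimately have "v z = 0" using unique[of v z] \<open>z \<in> \<Omega>\<close> by simp
    then show ?thesis by (simp add: v_def)
  qed
  define p where "p = embed_pmf (\<lambda>z. if z \<in> \<Omega> then \<rho> z else 0)"
  have p: "pmf p z = (if z \<in> \<Omega> then \<rho> z else 0)" for z
    unfolding p_def
  proof (rule pmf_embed_pmf)
    have "(\<integral>\<^sup>+ x. ennreal (if x \<in> \<Omega> then \<rho> x else 0) \<partial>count_space UNIV)
        = (\<integral>\<^sup>+ x. ennreal (\<rho> x) * indicator \<Omega> x \<partial>count_space UNIV)"
      by (intro nn_integral_cong) auto
    also have "\<dots> = (\<Sum>x\<in>\<Omega>. ennreal (\<rho> x))"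
      using finite_states by (simp add: nn_integral_count_space_indicator[symmetric]
        nn_integral_count_space_finite)
    also have "\<dots> = 1" using \<rho>_nonneg \<rho>_sum by (simp add: sum_ennreal)
    finally show "(\<integral>\<^sup>+ x. ennreal (if x \<in> \<Omega> then \<rho> x else 0) \<partial>count_space UNIV) = 1" .
  qed (use \<rho>_nonneg in auto)
  have p_stat: "is_stationary \<Omega> r p"
    unfolding is_stationary_def using \<rho>_t by (auto simp: p set_pmf_eq split: if_splits)
  have "p' = p" if p': "is_stationary \<Omega> r p'" for p'
  proof (rule pmf_eqI)
    fix z
    have out: "pmf p' z = 0" if "z \<notin> \<Omega>" for z
      using p' that by (auto simp: is_stationary_def set_pmf_eq)
    have "pmf p' z - \<rho> z = 0" if "z \<in> \<Omega>"
    proof (rule unique)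
      have "(\<Sum>x\<in>\<Omega>. pmf p' x) = 1"
        using p' finite_states by (intro sum_pmf_eq_1) (auto simp: is_stationary_def)
      then show "(\<Sum>x\<in>\<Omega>. pmf p' x - \<rho> x) = 0" using \<rho>_sum by (simp add: sum_subtractf)
      show "(\<Sum>x\<in>\<Omega>. (pmf p' x - \<rho> x) * P T x z) = pmf p' z - \<rho> z" if "z \<in> \<Omega>" for z
        using p' \<open>0 \<le> T\<close> that
        by (simp add: left_diff_distrib sum_subtractf \<rho>_T is_stationary_def)
    qed fact
    then show "pmf p' z = pmf p z" using out by (auto simp: p)
  qed
  with p_stat have "(THE p. is_stationary \<Omega> r p) = p" by (rule the_equality)
  then have \<pi>: "\<pi> z = (if z \<in> \<Omega> then \<rho> z else 0)" for z
    by (simp add: \<pi>_def stationary_distribution_def p)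
  show "0 \<le> \<pi> x" if "x \<in> \<Omega>" using \<rho>_nonneg that by (simp add: \<pi>)
  show "(\<Sum>x\<in>\<Omega>. \<pi> x) = 1" using \<rho>_sum by (simp add: \<pi>)
  show "(\<Sum>x\<in>\<Omega>. \<pi> x * P t x z) = \<pi> z" if "0 \<le> t" "z \<in> \<Omega>"
    using \<rho>_t[OF that] that by (simp add: \<pi>)
  show "(\<lambda>m. P (real m * T) x z) \<longlonglongrightarrow> \<pi> z" if "x \<in> \<Omega>" "z \<in> \<Omega>"
    using conv[OF that] that by (simp add: \<pi>)
qed

section \<open>Ergodicity of the noisy voter model\<close>

lemma finite_configurations: "finite S \<Longrightarrow> finite (configurations S)"
  by (simp add: configurations_def finite_PiE)

lemma configuration_cases:
  assumes "\<eta> \<in> configurations S" "x \<in> S"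
  obtains "\<eta> x = 0" | "\<eta> x = 1"
  using assms by (auto simp: configurations_def PiE_iff)

lemma configurations_eqI:
  assumes "\<eta> \<in> configurations S" "\<xi> \<in> configurations S" "\<And>x. x \<in> S \<Longrightarrow> \<eta> x = \<xi> x"
  shows "\<eta> = \<xi>"
  using assms unfolding configurations_def by (rule PiE_ext)

lemma flip_in_configurations:
  assumes "\<eta> \<in> configurations S" "x \<in> S"
  shows "flip \<eta> x \<in> configurations S"
  using assms by (auto simp: configurations_def PiE_iff flip_def extensional_def)

lemma flip_same: "flip \<eta> x x = 1 - \<eta> x"
  and flip_other: "y \<noteq> x \<Longrightarrow> flip \<eta> x y = \<eta> y"
  by (simp_all add: flip_def)

lemma flip_neq:
  assumes "\<eta> \<in> configurations S" "x \<in> S"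
  shows "flip \<eta> x \<noteq> \<eta>"
proof
  assume "flip \<eta> x = \<eta>"
  then have "1 - \<eta> x = \<eta> x" by (metis flip_same)
  then show False using assms by (cases rule: configuration_cases[OF assms]) auto
qed

lemma divide_le_self:
  fixes a b :: real
  assumes "0 \<le> a" "1 \<le> b"
  shows "a / b \<le> a"
  using mult_left_mono[OF assms(2,1)] assms by (simp add: divide_le_eq)

locale voter_model =
  fixes S :: "'a set" and q :: "'a \<Rightarrow> 'a \<Rightarrow> real"
  assumes finite_sites: "finite S" and sites_nonempty: "S \<noteq> {}"
    and copy_rate_nonneg: "x \<in> S \<Longrightarrow> y \<in> S \<Longrightarrow> x \<noteq> y \<Longrightarrow> 0 \<le> q x y"
begin

text \<open>
  Rerandomization alone flips every site at rate \<open>1/2\<close>, which makes the chain irreducible.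
\<close>

lemma flip_rate_ge_half:
  assumes "\<eta> \<in> configurations S" "x \<in> S"
  shows "1/2 \<le> flip_rate S q \<eta> x"
proof -
  have "0 \<le> (\<Sum>y\<in>S - {x}. q x y * real (\<eta> y))"
    using copy_rate_nonneg assms by (intro sum_nonneg mult_nonneg_nonneg) auto
  moreover have "0 \<le> (\<Sum>y\<in>S - {x}. q x y * (1 - real (\<eta> y)))"
  proof (intro sum_nonneg mult_nonneg_nonneg)
    fix y assume y: "y \<in> S - {x}"
    then show "0 \<le> q x y" using copy_rate_nonneg assms by auto
    from y have "y \<in> S" by simp
    then show "0 \<le> 1 - real (\<eta> y)"
      using assms(1) by (auto elim: configuration_cases)
  qed
  ultimately show ?thesis by (simp add: flip_rate_def)
qed

sublocale finite_chain "configurations S" "voter_rate S q"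
proof
  show "finite (configurations S)" using finite_sites by (rule finite_configurations)
  show "0 \<le> voter_rate S q \<eta> \<xi>" if "\<eta> \<in> configurations S" for \<eta> \<xi>
  proof -
    have "0 \<le> flip_rate S q \<eta> x" if "x \<in> S" for x
      using flip_rate_ge_half[OF \<open>\<eta> \<in> _\<close> that] by simp
    then show ?thesis unfolding voter_rate_def by (intro sum_nonneg) auto
  qed
qed

lemma gen_voter:
  assumes "\<eta> \<in> configurations S"
  shows "gen f \<eta> = (\<Sum>x\<in>S. flip_rate S q \<eta> x * (f (flip \<eta> x) - f \<eta>))"
proof -
  have "gen f \<eta> = (\<Sum>\<xi>\<in>configurations S - {\<eta>}. \<Sum>x\<in>S.
      if \<xi> = flip \<eta> x then flip_rate S q \<eta> x * (f \<xi> - f \<eta>) else 0)"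
    unfolding gen_def voter_rate_def sum_distrib_right by (intro sum.cong) auto
  also have "\<dots> = (\<Sum>x\<in>S. \<Sum>\<xi>\<in>configurations S - {\<eta>}.
      if \<xi> = flip \<eta> x then flip_rate S q \<eta> x * (f \<xi> - f \<eta>) else 0)"
    by (rule sum.swap)
  also have "\<dots> = (\<Sum>x\<in>S. flip_rate S q \<eta> x * (f (flip \<eta> x) - f \<eta>))"
  proof (rule sum.cong)
    fix x assume "x \<in> S"
    then have "flip \<eta> x \<in> configurations S - {\<eta>}"
      using flip_in_configurations[OF assms] flip_neq[OF assms] by auto
    then show "(\<Sum>\<xi>\<in>configurations S - {\<eta>}.
        if \<xi> = flip \<eta> x then flip_rate S q \<eta> x * (f \<xi> - f \<eta>) else 0)
      = flip_rate S q \<eta> x * (f (flip \<eta> x) - f \<eta>)"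
      using finite_states by simp
  qed simp
  finally show ?thesis .
qed

text \<open>
  Compare with \<open>exp (- \<Lambda> t) (t / (2 N))\<^bsup>d\<^esup>\<close>, where \<open>d\<close> is the number of sites at which the
  configuration differs from the target \<open>\<zeta>\<close>, \<open>N\<close> is the number of sites and \<open>\<Lambda>\<close> bounds the total
  jump rate. Each of the \<open>d\<close> wrong sites is corrected at rate at least \<open>1/2\<close>, and this outweighs the
  growth of the power of \<open>t\<close>.
\<close>

lemma law_positive:
  obtains \<epsilon> where "0 < \<epsilon>"
    "\<And>\<eta> \<zeta>. \<eta> \<in> configurations S \<Longrightarrow> \<zeta> \<in> configurations S \<Longrightarrow> \<epsilon> \<le> P 1 \<eta> \<zeta>"
proof -
  define N where "N = real (card S)"
  define \<Lambda> where "\<Lambda> = (\<Sum>\<eta>\<in>configurations S. \<Sum>x\<in>S. flip_rate S q \<eta> x)"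
  have N: "1 \<le> N"
    using finite_sites sites_nonempty by (simp add: N_def Suc_le_eq card_gt_0_iff)
  have rate_nonneg: "0 \<le> flip_rate S q \<eta> x" if "\<eta> \<in> configurations S" "x \<in> S" for \<eta> x
    using flip_rate_ge_half[OF that] by simp
  have exit: "(\<Sum>x\<in>S. flip_rate S q \<eta> x) \<le> \<Lambda>" if "\<eta> \<in> configurations S" for \<eta>
    unfolding \<Lambda>_def using that finite_states rate_nonneg
    by (intro member_le_sum sum_nonneg) auto
  have bound: "exp (- \<Lambda>) * (1 / (2 * N)) ^ card S \<le> P 1 \<eta> \<zeta>"
    if \<eta>: "\<eta> \<in> configurations S" and \<zeta>: "\<zeta> \<in> configurations S" for \<eta> \<zeta>
  proof -
    define D where "D \<eta> = {x \<in> S. \<eta> x \<noteq> \<zeta> x}" for \<eta>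
    define v where "v t \<eta> = exp (- \<Lambda> * t) * (t / (2 * N)) ^ card (D \<eta>)" for t \<eta>
    define v' where "v' t \<eta> = exp (- \<Lambda> * t) * (real (card (D \<eta>)) * (t / (2 * N)) ^ (card (D \<eta>) - 1) / (2 * N))
      - \<Lambda> * v t \<eta>" for t \<eta>
    have D_fin: "finite (D \<eta>)" for \<eta> using finite_sites by (simp add: D_def)
    have D_flip: "card (D (flip \<eta> x)) = card (D \<eta>) - 1" if "\<eta> \<in> configurations S" "x \<in> D \<eta>" for \<eta> x
    proof -
      have "x \<in> S" using that by (simp add: D_def)
      then have "D (flip \<eta> x) = D \<eta> - {x}"
        using that by (cases rule: configuration_cases[OF that(1) \<open>x \<in> S\<close>];
            cases rule: configuration_cases[OF \<zeta> \<open>x \<in> S\<close>]) (auto simp: D_def flip_def)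
      then show ?thesis using that D_fin by simp
    qed
    have "v 1 \<eta> \<le> expect 1 (\<lambda>\<xi>. if \<xi> = \<zeta> then 1 else 0) \<eta>"
    proof (rule subsolution_le_expect[where v' = v'])
      show "((\<lambda>t. v t \<eta>) has_real_derivative v' t \<eta>) (at t)" for t \<eta>
      proof -
        let ?k = "card (D \<eta>)"
        have "((\<lambda>t. t / (2 * N)) has_real_derivative 1 / (2 * N)) (at t)"
          by (intro DERIV_cdivide DERIV_ident)
        from DERIV_power[OF this, of ?k]
        have "((\<lambda>t. (t / (2 * N)) ^ ?k) has_real_derivative
            real ?k * (t / (2 * N)) ^ (?k - 1) / (2 * N)) (at t)" by simp
        moreover have "((\<lambda>t. exp (- \<Lambda> * t)) has_real_derivative - \<Lambda> * exp (- \<Lambda> * t)) (at t)"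
          by (auto intro!: derivative_eq_intros)
        ultimately show ?thesis
          unfolding v'_def v_def by (auto dest: DERIV_mult simp: algebra_simps)
      qed
      show "v' t \<eta> \<le> gen (v t) \<eta>" if t: "0 \<le> t" and \<eta>: "\<eta> \<in> configurations S" for t \<eta>
      proof -
        let ?w = "exp (- \<Lambda> * t) * (t / (2 * N)) ^ (card (D \<eta>) - 1)"
        have v_nonneg: "0 \<le> v t \<xi>" for \<xi> using t N by (simp add: v_def)
        have w_nonneg: "0 \<le> ?w" using t N by simp
        have "exp (- \<Lambda> * t) * (real (card (D \<eta>)) * (t / (2 * N)) ^ (card (D \<eta>) - 1) / (2 * N))
          = real (card (D \<eta>)) * ((1/2) * ?w) / N" by simp
        also have "\<dots> \<le> real (card (D \<eta>)) * ((1/2) * ?w)"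
          using N w_nonneg by (intro divide_le_self) auto
        also have "\<dots> = (\<Sum>x\<in>D \<eta>. (1/2) * v t (flip \<eta> x))"
          using D_flip[OF \<eta>] by (simp add: v_def)
        also have "\<dots> \<le> (\<Sum>x\<in>D \<eta>. flip_rate S q \<eta> x * v t (flip \<eta> x))"
          using flip_rate_ge_half[OF \<eta>] v_nonneg
          by (intro sum_mono mult_right_mono) (auto simp: D_def)
        also have "\<dots> \<le> (\<Sum>x\<in>S. flip_rate S q \<eta> x * v t (flip \<eta> x))"
          using finite_sites rate_nonneg[OF \<eta>] v_nonneg
          by (intro sum_mono2) (auto simp: D_def)
        finally have "v' t \<eta> \<le> (\<Sum>x\<in>S. flip_rate S q \<eta> x * v t (flip \<eta> x)) - \<Lambda> * v t \<eta>"
          by (simp add: v'_def)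
        also have "\<dots> \<le> (\<Sum>x\<in>S. flip_rate S q \<eta> x * v t (flip \<eta> x)) - (\<Sum>x\<in>S. flip_rate S q \<eta> x) * v t \<eta>"
          using mult_right_mono[OF exit[OF \<eta>] v_nonneg] by simp
        also have "\<dots> = gen (v t) \<eta>"
          by (simp add: gen_voter[OF \<eta>] right_diff_distrib sum_subtractf sum_distrib_right)
        finally show ?thesis .
      qed
      show "v 0 \<eta> \<le> (if \<eta> = \<zeta> then 1 else 0)" if "\<eta> \<in> configurations S" for \<eta>
      proof (cases "\<eta> = \<zeta>")
        case False
        then have "D \<eta> \<noteq> {}" using configurations_eqI[OF that \<zeta>] by (auto simp: D_def)
        then have "card (D \<eta>) \<noteq> 0" using D_fin by simp
        then show ?thesis using False by (simp add: v_def power_0_left)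
      qed (simp add: v_def D_def)
    qed (use \<eta> in auto)
    then have "v 1 \<eta> \<le> P 1 \<eta> \<zeta>" using law_eq_expect[OF \<eta> \<zeta>] by simp
    moreover have "exp (- \<Lambda>) * (1 / (2 * N)) ^ card S \<le> v 1 \<eta>"
    proof -
      have "card (D \<eta>) \<le> card S" using finite_sites by (intro card_mono) (auto simp: D_def)
      then have "(1 / (2 * N)) ^ card S \<le> (1 / (2 * N)) ^ card (D \<eta>)"
        using N by (intro power_decreasing) auto
      then show ?thesis by (simp add: v_def)
    qed
    ultimately show ?thesis by linarith
  qed
  show ?thesis by (rule that[OF _ bound]) (use N in simp)
qed

abbreviation "\<pi> \<equiv> stationary_distribution (configurations S) (voter_rate S q)"

lemma stationary:
  shows "\<eta> \<in> configurations S \<Longrightarrow> 0 \<le> \<pi> \<eta>"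
    and "(\<Sum>\<eta>\<in>configurations S. \<pi> \<eta>) = 1"
    and "0 \<le> t \<Longrightarrow> \<xi> \<in> configurations S \<Longrightarrow> (\<Sum>\<eta>\<in>configurations S. \<pi> \<eta> * P t \<eta> \<xi>) = \<pi> \<xi>"
    and "\<eta> \<in> configurations S \<Longrightarrow> \<xi> \<in> configurations S \<Longrightarrow> (\<lambda>m. P (real m) \<eta> \<xi>) \<longlonglongrightarrow> \<pi> \<xi>"
proof -
  obtain \<epsilon> where \<epsilon>: "0 < \<epsilon>"
    "\<And>\<eta> \<zeta>. \<eta> \<in> configurations S \<Longrightarrow> \<zeta> \<in> configurations S \<Longrightarrow> \<epsilon> \<le> P 1 \<eta> \<zeta>"
    using law_positive by blast
  have zero: "(\<lambda>x\<in>S. 0) \<in> configurations S" by (auto simp: configurations_def)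
  note * = law_convergent_stationary[OF \<epsilon>(2)[OF _ zero] \<epsilon>(1) zero_le_one zero]
  show "\<eta> \<in> configurations S \<Longrightarrow> 0 \<le> \<pi> \<eta>" by (rule *(1))
  show "(\<Sum>\<eta>\<in>configurations S. \<pi> \<eta>) = 1" by (rule *(2))
  show "0 \<le> t \<Longrightarrow> \<xi> \<in> configurations S \<Longrightarrow> (\<Sum>\<eta>\<in>configurations S. \<pi> \<eta> * P t \<eta> \<xi>) = \<pi> \<xi>"
    by (rule *(3))
  show "\<eta> \<in> configurations S \<Longrightarrow> \<xi> \<in> configurations S \<Longrightarrow> (\<lambda>m. P (real m) \<eta> \<xi>) \<longlonglongrightarrow> \<pi> \<xi>"
    using *(4)[of \<eta> \<xi>] by simp
qed

lemma stationary_expect: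
  assumes "0 \<le> t"
  shows "(\<Sum>\<eta>\<in>configurations S. \<pi> \<eta> * expect t f \<eta>) = (\<Sum>\<eta>\<in>configurations S. \<pi> \<eta> * f \<eta>)"
proof -
  have "(\<Sum>\<eta>\<in>configurations S. \<pi> \<eta> * expect t f \<eta>)
      = (\<Sum>\<xi>\<in>configurations S. (\<Sum>\<eta>\<in>configurations S. \<pi> \<eta> * P t \<eta> \<xi>) * f \<xi>)"
    unfolding expect_def sum_distrib_left sum_distrib_right
    by (subst sum.swap) (simp add: mult.assoc)
  also have "\<dots> = (\<Sum>\<eta>\<in>configurations S. \<pi> \<eta> * f \<eta>)"
    using stationary(3)[OF assms] by (intro sum.cong) auto
  finally show ?thesis .
qed

end

section \<open>The noisy voter model on the star\<close>

definition ones :: "nat \<Rightarrow> (star_vertex \<Rightarrow> nat) \<Rightarrow> nat" where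
  "ones n \<eta> = card {x \<in> leaves n. \<eta> x = 1}"

lemma finite_leaves: "finite (leaves n)"
  by (simp add: leaves_def)

lemma card_leaves: "card (leaves n) = n"
  by (simp add: leaves_def card_image inj_on_def)

lemma Center_notin_leaves: "Center \<notin> leaves n"
  by (auto simp: leaves_def)

lemma ones_le: "ones n \<eta> \<le> n"
  unfolding ones_def using card_mono[OF finite_leaves, of "{x \<in> leaves n. \<eta> x = 1}" n]
  by (simp add: card_leaves)

lemma sum_star: "(\<Sum>x\<in>star n. f x) = f Center + (\<Sum>x\<in>leaves n. f x)"
  for f :: "star_vertex \<Rightarrow> real"
  by (simp add: star_def finite_leaves Center_notin_leaves)

lemma leaf_in_star: "x \<in> leaves n \<Longrightarrow> x \<in> star n"
  and Center_in_star: "Center \<in> star n"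
  by (simp_all add: star_def)

lemma sum_leaves_ones:
  assumes "\<eta> \<in> configurations (star n)"
  shows "(\<Sum>x\<in>leaves n. real (\<eta> x)) = real (ones n \<eta>)"
proof -
  have "(\<Sum>x\<in>leaves n. real (\<eta> x)) = (\<Sum>x\<in>leaves n. if \<eta> x = 1 then 1 else 0)"
    by (intro sum.cong) (auto elim: configuration_cases[OF assms leaf_in_star])
  also have "\<dots> = real (ones n \<eta>)"
    using finite_leaves by (simp add: ones_def sum.If_cases Int_def)
  finally show ?thesis .
qed

locale star_model =
  fixes n :: nat
  assumes n_pos: "0 < n"
begin

sublocale voter_model "star n" "star_rate n"
proof
  show "finite (star n)" by (simp add: star_def finite_leaves)
  show "star n \<noteq> {}" by (simp add: star_def)
  show "0 \<le> star_rate n x y" for x y by (simp add: star_rate_def walk_rate_def)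
qed

abbreviation "\<Omega> \<equiv> configurations (star n)"
abbreviation "rate \<equiv> flip_rate (star n) (star_rate n)"

lemma config_Center: "\<eta> \<in> \<Omega> \<Longrightarrow> \<eta> Center = 0 \<or> \<eta> Center = 1"
  by (auto elim: configuration_cases[OF _ Center_in_star])

lemma config_leaf: "\<eta> \<in> \<Omega> \<Longrightarrow> x \<in> leaves n \<Longrightarrow> \<eta> x = 0 \<or> \<eta> x = 1"
  by (auto elim: configuration_cases[OF _ leaf_in_star])

lemma rate_leaf:
  assumes "x \<in> leaves n"
  shows "rate \<eta> x = (if \<eta> x = 0 then 1/2 + real (\<eta> Center) else 3/2 - real (\<eta> Center))"
proof -
  have "star n - {x} = insert Center (leaves n - {x})"
    using assms Center_notin_leaves by (auto simp: star_def)
  then have "(\<Sum>y\<in>star n - {x}. star_rate n x y * g y) = g Center" for g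
    using assms finite_leaves Center_notin_leaves
    by (simp add: star_rate_simps(1,4))
  then show ?thesis by (simp add: flip_rate_def)
qed

lemma rate_Center:
  assumes "\<eta> \<in> \<Omega>"
  shows "rate \<eta> Center = (if \<eta> Center = 0 then 1/2 + real (ones n \<eta>) / real n
    else 3/2 - real (ones n \<eta>) / real n)"
proof -
  have "star n - {Center} = leaves n"
    using Center_notin_leaves by (auto simp: star_def)
  then have "(\<Sum>y\<in>star n - {Center}. star_rate n Center y * g y) = (\<Sum>y\<in>leaves n. g y) / n" for g
    by (simp add: star_rate_simps(2) sum_divide_distrib)
  then show ?thesis using n_pos
    by (simp add: flip_rate_def sum_leaves_ones[OF assms] sum_subtractf card_leaves diff_divide_distrib)
qed

lemma rate_Center_bounds:
  assumes "\<eta> \<in> \<Omega>"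
  shows "1/2 \<le> rate \<eta> Center" "rate \<eta> Center \<le> 3/2"
proof -
  define p where "p = real (ones n \<eta>) / real n"
  have "p \<le> 1" "0 \<le> p" using ones_le[of n \<eta>] n_pos by (auto simp: p_def divide_le_eq)
  then show "1/2 \<le> rate \<eta> Center" "rate \<eta> Center \<le> 3/2"
    unfolding rate_Center[OF assms] p_def[symmetric] by auto
qed

lemma gen_star:
  assumes "\<eta> \<in> \<Omega>"
  shows "gen f \<eta> = rate \<eta> Center * (f (flip \<eta> Center) - f \<eta>)
    + (\<Sum>x\<in>leaves n. rate \<eta> x * (f (flip \<eta> x) - f \<eta>))"
  by (simp add: gen_voter[OF assms] sum_star)

text \<open>
  The expected rate of change of a leaf state, in the same form for both values of the leaf.
\<close>

lemma leaf_drift: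
  assumes "\<eta> \<in> \<Omega>" "x \<in> leaves n"
  shows "rate \<eta> x * (1 - 2 * real (\<eta> x)) = 1/2 + real (\<eta> Center) - 2 * real (\<eta> x)"
  using config_leaf[OF assms] by (auto simp: rate_leaf[OF assms(2)])

end

section \<open>Slow mixing from a balanced configuration\<close>

text \<open>
  The centered function \<open>f - M/2\<close> has the same mean difference \<open>M\<close> as \<open>f\<close>. By the Cauchy-Schwarz
  inequality with weights \<open>\<bar>m1 - m2\<bar> \<le> m1 + m2\<close>, the square of \<open>M\<close> is at most twice the distance
  times the second moment of \<open>f - M/2\<close> under \<open>m1 + m2\<close>, which is at most \<open>2 V + M\<^sup>2 / 2\<close>.
\<close>

lemma tv_dist_ge_of_moments:
  fixes m1 m2 f :: "'s \<Rightarrow> real"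
  assumes m1: "\<And>x. x \<in> \<Omega> \<Longrightarrow> 0 \<le> m1 x" "(\<Sum>x\<in>\<Omega>. m1 x) = 1"
    and m2: "\<And>x. x \<in> \<Omega> \<Longrightarrow> 0 \<le> m2 x" "(\<Sum>x\<in>\<Omega>. m2 x) = 1"
    and mean1: "(\<Sum>x\<in>\<Omega>. m1 x * f x) = M" and mean2: "(\<Sum>x\<in>\<Omega>. m2 x * f x) = 0"
    and sq1: "(\<Sum>x\<in>\<Omega>. m1 x * (f x)\<^sup>2) \<le> M\<^sup>2 + V" and sq2: "(\<Sum>x\<in>\<Omega>. m2 x * (f x)\<^sup>2) \<le> V"
    and V: "0 < V"
  shows "M\<^sup>2 / (4 * V + M\<^sup>2) \<le> tv_dist \<Omega> m1 m2"
proof -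
  let ?d = "\<lambda>x. \<bar>m1 x - m2 x\<bar>" and ?g = "\<lambda>x. f x - M / 2"
  have "M = (\<Sum>x\<in>\<Omega>. (m1 x - m2 x) * ?g x)"
    using mean1 mean2 m1(2) m2(2)
    by (simp add: algebra_simps sum.distrib sum_subtractf sum_divide_distrib[symmetric]
        sum_distrib_left[symmetric])
  also have "\<dots> = (\<Sum>x\<in>\<Omega>. (sgn (m1 x - m2 x) * ?g x * sqrt (?d x)) * sqrt (?d x))"
  proof (rule sum.cong)
    show "(m1 x - m2 x) * ?g x = (sgn (m1 x - m2 x) * ?g x * sqrt (?d x)) * sqrt (?d x)" for x
    proof -
      have "m1 x - m2 x = sgn (m1 x - m2 x) * (sqrt (?d x) * sqrt (?d x))"
        by (simp add: sgn_mult_abs)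
      then show ?thesis by (metis mult.assoc mult.commute)
    qed
  qed simp
  finally have "M\<^sup>2 = (\<Sum>x\<in>\<Omega>. (sgn (m1 x - m2 x) * ?g x * sqrt (?d x)) * sqrt (?d x))\<^sup>2"
    by simp
  also have "\<dots> \<le> (\<Sum>x\<in>\<Omega>. (sgn (m1 x - m2 x) * ?g x * sqrt (?d x))\<^sup>2) * (\<Sum>x\<in>\<Omega>. (sqrt (?d x))\<^sup>2)"
    by (rule Cauchy_Schwarz_ineq_sum)
  also have "(\<Sum>x\<in>\<Omega>. (sqrt (?d x))\<^sup>2) = 2 * tv_dist \<Omega> m1 m2"
    by (simp add: tv_dist_def)
  also have "(\<Sum>x\<in>\<Omega>. (sgn (m1 x - m2 x) * ?g x * sqrt (?d x))\<^sup>2) * (2 * tv_dist \<Omega> m1 m2)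
      \<le> (2 * V + M\<^sup>2 / 2) * (2 * tv_dist \<Omega> m1 m2)"
  proof (rule mult_right_mono)
    have "(\<Sum>x\<in>\<Omega>. (sgn (m1 x - m2 x) * ?g x * sqrt (?d x))\<^sup>2) \<le> (\<Sum>x\<in>\<Omega>. (m1 x + m2 x) * (?g x)\<^sup>2)"
    proof (rule sum_mono)
      fix x assume "x \<in> \<Omega>"
      have "(sgn (m1 x - m2 x) * ?g x * sqrt (?d x))\<^sup>2 = (sgn (m1 x - m2 x))\<^sup>2 * (?g x)\<^sup>2 * ?d x"
        by (simp add: power_mult_distrib)
      also have "\<dots> = ?d x * (?g x)\<^sup>2" by (simp add: sgn_real_def)
      also have "\<dots> \<le> (m1 x + m2 x) * (?g x)\<^sup>2"
        using m1(1)[OF \<open>x \<in> \<Omega>\<close>] m2(1)[OF \<open>x \<in> \<Omega>\<close>] by (intro mult_right_mono) auto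
      finally show "(sgn (m1 x - m2 x) * ?g x * sqrt (?d x))\<^sup>2 \<le> (m1 x + m2 x) * (?g x)\<^sup>2" .
    qed
    also have "\<dots> = (\<Sum>x\<in>\<Omega>. m1 x * (f x)\<^sup>2) + (\<Sum>x\<in>\<Omega>. m2 x * (f x)\<^sup>2)
        - M * ((\<Sum>x\<in>\<Omega>. m1 x * f x) + (\<Sum>x\<in>\<Omega>. m2 x * f x))
        + M\<^sup>2 / 4 * ((\<Sum>x\<in>\<Omega>. m1 x) + (\<Sum>x\<in>\<Omega>. m2 x))"
      unfolding sum_distrib_left sum.distrib[symmetric] sum_subtractf[symmetric]
      by (intro sum.cong) (auto simp: power2_eq_square field_simps)
    also have "\<dots> \<le> 2 * V + M\<^sup>2 / 2"
      using sq1 sq2 mean1 mean2 m1(2) m2(2) by (simp add: power2_eq_square)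
    finally show "(\<Sum>x\<in>\<Omega>. (sgn (m1 x - m2 x) * ?g x * sqrt (?d x))\<^sup>2) \<le> 2 * V + M\<^sup>2 / 2" .
    show "0 \<le> 2 * tv_dist \<Omega> m1 m2" by (simp add: tv_dist_def sum_nonneg)
  qed
  also have "\<dots> = (4 * V + M\<^sup>2) * tv_dist \<Omega> m1 m2" by (simp add: algebra_simps)
  finally show ?thesis
    using V by (simp add: divide_le_eq add_pos_nonneg mult.commute)
qed

context star_model
begin

text \<open>
  The center contributes the same drift to every leaf, which cancels since the signs \<open>s\<close> sum to 0. In
  the square, each leaf adds its flip rate, at most \<open>3/2\<close>, because a flip changes \<open>f\<close> by \<open>\<plusminus>1\<close>.
\<close>

lemma gen_signed_sum:
  assumes s: "(\<Sum>x\<in>leaves n. s x) = 0" "\<forall>x\<in>leaves n. (s x)\<^sup>2 = 1" and \<eta>: "\<eta> \<in> \<Omega>"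
  defines "f \<equiv> \<lambda>\<eta>. \<Sum>x\<in>leaves n. s x * real (\<eta> x)"
  shows "gen f \<eta> = - 2 * f \<eta>"
    and "gen (\<lambda>\<eta>. (f \<eta>)\<^sup>2) \<eta> \<le> - 4 * (f \<eta>)\<^sup>2 + 3/2 * real n"
proof -
  have f_Center: "f (flip \<eta> Center) = f \<eta>"
    unfolding f_def using Center_notin_leaves by (intro sum.cong) (auto simp: flip_def)
  have f_leaf: "f (flip \<eta> x) = f \<eta> + s x * (1 - 2 * real (\<eta> x))" if x: "x \<in> leaves n" for x
  proof -
    have "f (flip \<eta> x) = s x * real (flip \<eta> x x) + (\<Sum>y\<in>leaves n - {x}. s y * real (flip \<eta> x y))"
      unfolding f_def using x finite_leaves by (simp add: sum.remove)
    also have "(\<Sum>y\<in>leaves n - {x}. s y * real (flip \<eta> x y)) = (\<Sum>y\<in>leaves n - {x}. s y * real (\<eta> y))"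
      by (intro sum.cong) (auto simp: flip_other)
    also have "\<dots> = f \<eta> - s x * real (\<eta> x)"
      unfolding f_def using x finite_leaves by (simp add: sum_diff1)
    finally show ?thesis
      using config_leaf[OF \<eta> x] by (auto simp: flip_same algebra_simps)
  qed
  have "gen f \<eta> = (\<Sum>x\<in>leaves n. s x * (rate \<eta> x * (1 - 2 * real (\<eta> x))))"
    by (simp add: gen_star[OF \<eta>] f_Center f_leaf mult_ac)
  also have "\<dots> = (\<Sum>x\<in>leaves n. s x * (1/2 + real (\<eta> Center)) - 2 * (s x * real (\<eta> x)))"
    by (intro sum.cong refl, simp only: leaf_drift[OF \<eta>]) (simp add: algebra_simps)
  also have "\<dots> = (\<Sum>x\<in>leaves n. s x) * (1/2 + real (\<eta> Center)) - 2 * f \<eta>"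
    unfolding f_def sum_distrib_left sum_distrib_right by (rule sum_subtractf)
  finally show 1: "gen f \<eta> = - 2 * f \<eta>" using s(1) by simp
  have "gen (\<lambda>\<eta>. (f \<eta>)\<^sup>2) \<eta> = (\<Sum>x\<in>leaves n. rate \<eta> x * ((f (flip \<eta> x))\<^sup>2 - (f \<eta>)\<^sup>2))"
    by (simp add: gen_star[OF \<eta>] f_Center)
  also have "\<dots> = (\<Sum>x\<in>leaves n. 2 * f \<eta> * (rate \<eta> x * (f (flip \<eta> x) - f \<eta>)) + rate \<eta> x)"
  proof (intro sum.cong refl)
    fix x assume x: "x \<in> leaves n"
    have "(1 - 2 * real (\<eta> x))\<^sup>2 = 1" using config_leaf[OF \<eta> x] by auto
    then have "(f (flip \<eta> x) - f \<eta>)\<^sup>2 = 1"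
      using s(2) x by (simp add: f_leaf[OF x] power_mult_distrib)
    then have "(f (flip \<eta> x))\<^sup>2 - (f \<eta>)\<^sup>2 = 2 * f \<eta> * (f (flip \<eta> x) - f \<eta>) + 1"
      by (simp add: power2_diff algebra_simps power2_eq_square)
    then show "rate \<eta> x * ((f (flip \<eta> x))\<^sup>2 - (f \<eta>)\<^sup>2)
        = 2 * f \<eta> * (rate \<eta> x * (f (flip \<eta> x) - f \<eta>)) + rate \<eta> x"
      by (simp only: distrib_left mult_1_right mult_ac)
  qed
  also have "\<dots> = 2 * f \<eta> * gen f \<eta> + (\<Sum>x\<in>leaves n. rate \<eta> x)"
    by (simp add: gen_star[OF \<eta>] f_Center sum.distrib sum_distrib_left)
  also have "(\<Sum>x\<in>leaves n. rate \<eta> x) \<le> (\<Sum>x\<in>leaves n. 3/2)"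
    using config_Center[OF \<eta>] by (intro sum_mono) (auto simp: rate_leaf)
  finally show "gen (\<lambda>\<eta>. (f \<eta>)\<^sup>2) \<eta> \<le> - 4 * (f \<eta>)\<^sup>2 + 3/2 * real n"
    by (simp add: 1 card_leaves power2_eq_square)
qed

lemma expect_signed_sum:
  assumes s: "(\<Sum>x\<in>leaves n. s x) = 0" "\<forall>x\<in>leaves n. (s x)\<^sup>2 = 1"
    and "\<eta> \<in> \<Omega>" "0 \<le> t"
  defines "f \<equiv> \<lambda>\<eta>. \<Sum>x\<in>leaves n. s x * real (\<eta> x)"
  shows "expect t f \<eta> = exp (- 2 * t) * f \<eta>"
    and "expect t (\<lambda>\<eta>. (f \<eta>)\<^sup>2) \<eta> \<le> exp (- 4 * t) * (f \<eta>)\<^sup>2 + 3/8 * real n * (1 - exp (- 4 * t))"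
proof -
  have f: "f \<eta> = (\<Sum>x\<in>leaves n. s x * real (\<eta> x))" for \<eta> by (simp add: f_def)
  note gen = gen_signed_sum[OF s, folded f]
  show "expect t f \<eta> = exp (- 2 * t) * f \<eta>"
  proof (rule expect_unique[where v = "\<lambda>t \<eta>. exp (- 2 * t) * f \<eta>"])
    show "((\<lambda>t. exp (- 2 * t) * f \<eta>) has_real_derivative gen (\<lambda>\<eta>. exp (- 2 * t) * f \<eta>) \<eta>) (at t)"
      if "\<eta> \<in> \<Omega>" for t \<eta>
      unfolding gen_mult gen(1)[OF that] by (auto intro!: derivative_eq_intros)
  qed (use assms(3,4) in auto)
  show "expect t (\<lambda>\<eta>. (f \<eta>)\<^sup>2) \<eta> \<le> exp (- 4 * t) * (f \<eta>)\<^sup>2 + 3/8 * real n * (1 - exp (- 4 * t))"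
  proof (rule expect_le_supersolution[where v' = "\<lambda>t \<eta>. exp (- 4 * t) * (- 4 * (f \<eta>)\<^sup>2 + 3/2 * real n)"])
    show "((\<lambda>t. exp (- 4 * t) * (f \<eta>)\<^sup>2 + 3/8 * real n * (1 - exp (- 4 * t)))
        has_real_derivative exp (- 4 * t) * (- 4 * (f \<eta>)\<^sup>2 + 3/2 * real n)) (at t)" for t \<eta>
      by (auto intro!: derivative_eq_intros simp: algebra_simps)
    show "gen (\<lambda>\<eta>. exp (- 4 * t) * (f \<eta>)\<^sup>2 + 3/8 * real n * (1 - exp (- 4 * t))) \<eta>
        \<le> exp (- 4 * t) * (- 4 * (f \<eta>)\<^sup>2 + 3/2 * real n)" if "\<eta> \<in> \<Omega>" for t \<eta>
      unfolding gen_add gen_mult gen_const using gen(2)[OF that] by simp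
  qed (use assms(3,4) in auto)
qed

text \<open>
  Stationarity turns the moment formulas at time \<open>t\<close> into fixed point relations, which give the mean
  0 and the second moment bound in equilibrium.
\<close>

lemma tv_lower_bound:
  assumes \<eta>: "\<eta> \<in> \<Omega>" and half: "ones n \<eta> = n div 2" "even n" and t: "0 < t"
  defines "E \<equiv> real n * exp (- 4 * t)"
  shows "E / (6 + E) \<le> tv_dist \<Omega> (P t \<eta>) \<pi>"
proof -
  define s where "s x = 2 * real (\<eta> x) - 1" for x
  define f where "f \<xi> = (\<Sum>x\<in>leaves n. s x * real (\<xi> x))" for \<xi>
  define M V where "M = exp (- 2 * t) * (real n / 2)" and "V = 3/8 * real n"
  have halfn: "real (ones n \<eta>) = real n / 2" using half by (auto elim: evenE)
  have s: "(\<Sum>x\<in>leaves n. s x) = 0" "\<forall>x\<in>leaves n. (s x)\<^sup>2 = 1"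
  proof -
    show "(\<Sum>x\<in>leaves n. s x) = 0"
      using halfn by (simp add: s_def sum_subtractf sum_distrib_left[symmetric]
          sum_leaves_ones[OF \<eta>] card_leaves)
    show "\<forall>x\<in>leaves n. (s x)\<^sup>2 = 1"
      using config_leaf[OF \<eta>] by (fastforce simp: s_def)
  qed
  note moments = expect_signed_sum[OF s, folded f_def]
  have "f \<eta> = (\<Sum>x\<in>leaves n. real (\<eta> x))"
    unfolding f_def by (intro sum.cong) (use config_leaf[OF \<eta>] in \<open>auto simp: s_def\<close>)
  then have f\<eta>: "f \<eta> = real n / 2" by (simp add: sum_leaves_ones[OF \<eta>] halfn)
  have t0: "0 \<le> t" using t by simp
  have exp4: "exp (- 4 * t) = (exp (- 2 * t))\<^sup>2" by (simp add: power2_eq_square exp_add[symmetric])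
  have lt1: "exp (- 4 * t) < 1" using t by simp
  have "(\<Sum>\<xi>\<in>\<Omega>. \<pi> \<xi> * f \<xi>) = (\<Sum>\<xi>\<in>\<Omega>. \<pi> \<xi> * (exp (- 2 * t) * f \<xi>))"
    unfolding stationary_expect[OF t0, of f, symmetric] by (intro sum.cong) (simp_all add: moments(1) t0)
  then have "(1 - exp (- 2 * t)) * (\<Sum>\<xi>\<in>\<Omega>. \<pi> \<xi> * f \<xi>) = 0"
    by (simp add: mult.left_commute[of "\<pi> _"] sum_distrib_left[symmetric] left_diff_distrib)
  moreover have "exp (- 2 * t) < 1" using t by simp
  ultimately have mean2: "(\<Sum>\<xi>\<in>\<Omega>. \<pi> \<xi> * f \<xi>) = 0" by auto
  let ?m = "\<Sum>\<xi>\<in>\<Omega>. \<pi> \<xi> * (f \<xi>)\<^sup>2"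
  have "?m = (\<Sum>\<xi>\<in>\<Omega>. \<pi> \<xi> * expect t (\<lambda>\<xi>. (f \<xi>)\<^sup>2) \<xi>)"
    using stationary_expect[OF t0] by simp
  also have "\<dots> \<le> (\<Sum>\<xi>\<in>\<Omega>. \<pi> \<xi> * (exp (- 4 * t) * (f \<xi>)\<^sup>2 + V * (1 - exp (- 4 * t))))"
    unfolding V_def using stationary(1) by (intro sum_mono mult_left_mono moments(2) t0) auto
  also have "\<dots> = exp (- 4 * t) * ?m + V * (1 - exp (- 4 * t))"
  proof -
    have "(\<Sum>\<xi>\<in>\<Omega>. \<pi> \<xi> * (exp (- 4 * t) * (f \<xi>)\<^sup>2)) = exp (- 4 * t) * ?m"
      by (simp add: sum_distrib_left mult_ac)
    then show ?thesis
      using stationary(2) by (simp add: distrib_left sum.distrib sum_distrib_right[symmetric])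
  qed
  finally have "(1 - exp (- 4 * t)) * ?m \<le> (1 - exp (- 4 * t)) * V" by (simp add: algebra_simps)
  then have sq2: "?m \<le> V" using lt1 by simp
  have "M\<^sup>2 / (4 * V + M\<^sup>2) \<le> tv_dist \<Omega> (P t \<eta>) \<pi>"
  proof (rule tv_dist_ge_of_moments[where f = f])
    show "(\<Sum>\<xi>\<in>\<Omega>. P t \<eta> \<xi> * f \<xi>) = M"
      using moments(1)[OF \<eta> t0] by (simp add: expect_def M_def f\<eta>)
    have "(\<Sum>\<xi>\<in>\<Omega>. P t \<eta> \<xi> * (f \<xi>)\<^sup>2) \<le> exp (- 4 * t) * (f \<eta>)\<^sup>2 + V * (1 - exp (- 4 * t))"
      using moments(2)[OF \<eta> t0] by (simp add: expect_def V_def)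
    also have "\<dots> \<le> M\<^sup>2 + V"
      unfolding M_def exp4 f\<eta> power_mult_distrib by (simp add: V_def algebra_simps)
    finally show "(\<Sum>\<xi>\<in>\<Omega>. P t \<eta> \<xi> * (f \<xi>)\<^sup>2) \<le> M\<^sup>2 + V" .
    show "0 < V" using n_pos by (simp add: V_def)
  qed (use mean2 sq2 stationary law_nonneg law_sum t0 \<eta> in auto)
  moreover have "M\<^sup>2 / (4 * V + M\<^sup>2) = E / (6 + E)"
  proof -
    have e1: "M\<^sup>2 = real n / 4 * E"
      unfolding M_def E_def exp4 power_mult_distrib by (simp add: power2_eq_square)
    have e2: "4 * V + real n / 4 * E = real n / 4 * (6 + E)"
      by (simp add: V_def algebra_simps)
    show ?thesis
      unfolding e1 e2 using n_pos by (intro mult_divide_mult_cancel_left) simp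
  qed
  ultimately show ?thesis by simp
qed

end

section \<open>Sums of independent Bernoulli variables\<close>

text \<open>
  The expectation of \<open>h\<close> applied to the number of successes of independent trials indexed by \<open>I\<close>, with
  success probabilities \<open>p\<close>.
\<close>

definition bern_expect :: "'i set \<Rightarrow> ('i \<Rightarrow> real) \<Rightarrow> (nat \<Rightarrow> real) \<Rightarrow> real" where
  "bern_expect I p h = (\<Sum>J\<in>Pow I. (\<Prod>i\<in>J. p i) * (\<Prod>i\<in>I - J. 1 - p i) * h (card J))"

lemma bern_expect_empty: "bern_expect {} p h = h 0"
  by (simp add: bern_expect_def)

text \<open>
  Conditioning on the outcome of one trial; this recursion carries all inductions below.
\<close>

lemma bern_expect_insert:
  assumes "finite I" "i \<notin> I"
  shows "bern_expect (insert i I) p h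
    = p i * bern_expect I p (\<lambda>s. h (Suc s)) + (1 - p i) * bern_expect I p h"
proof -
  let ?w = "\<lambda>J. (\<Prod>i\<in>J. p i) * (\<Prod>k\<in>insert i I - J. 1 - p k) * h (card J)"
  have fin: "finite J" if "J \<in> Pow I" for J using that assms(1) finite_subset by auto
  have "bern_expect (insert i I) p h = sum ?w (Pow I) + sum ?w (insert i ` Pow I)"
    unfolding bern_expect_def Pow_insert using assms by (intro sum.union_disjoint) auto
  also have "sum ?w (insert i ` Pow I) = (\<Sum>J\<in>Pow I. ?w (insert i J))"
    using assms(2) by (subst sum.reindex) (auto simp: inj_on_def insert_ident)
  also have "\<dots> = p i * bern_expect I p (\<lambda>s. h (Suc s))"
    unfolding bern_expect_def sum_distrib_left
  proof (rule sum.cong)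
    fix J assume J: "J \<in> Pow I"
    then have "i \<notin> J" "insert i I - insert i J = I - J" using assms(2) by auto
    then show "?w (insert i J) = p i * ((\<Prod>i\<in>J. p i) * (\<Prod>i\<in>I - J. 1 - p i) * h (Suc (card J)))"
      using fin[OF J] by simp
  qed simp
  also have "sum ?w (Pow I) = (1 - p i) * bern_expect I p h"
    unfolding bern_expect_def sum_distrib_left
  proof (rule sum.cong)
    fix J assume J: "J \<in> Pow I"
    then have "insert i I - J = insert i (I - J)" "i \<notin> I - J" using assms(2) by auto
    then show "?w J = (1 - p i) * ((\<Prod>i\<in>J. p i) * (\<Prod>i\<in>I - J. 1 - p i) * h (card J))"
      using assms(1) by simp
  qed simp
  finally show ?thesis by simp
qed

lemma bern_expect_remove:
  assumes "finite I" "i \<in> I"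
  shows "bern_expect I p h
    = p i * bern_expect (I - {i}) p (\<lambda>s. h (Suc s)) + (1 - p i) * bern_expect (I - {i}) p h"
  using bern_expect_insert[of "I - {i}" i p h] assms by (simp add: insert_absorb)

lemma bern_expect_cong:
  assumes "\<And>i. i \<in> I \<Longrightarrow> p i = p' i" "\<And>s. h s = h' s"
  shows "bern_expect I p h = bern_expect I p' h'"
  unfolding bern_expect_def using assms
  by (intro sum.cong arg_cong2[where f = "(*)"] prod.cong) auto

lemma bern_expect_diff:
  "bern_expect I p (\<lambda>s. h s - k s) = bern_expect I p h - bern_expect I p k"
  by (simp add: bern_expect_def algebra_simps sum_subtractf)

lemma bern_expect_cmult: "bern_expect I p (\<lambda>s. c * h s) = c * bern_expect I p h"
  by (simp add: bern_expect_def algebra_simps sum_distrib_left)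

lemma bern_expect_mono:
  assumes "\<And>i. i \<in> I \<Longrightarrow> 0 \<le> p i \<and> p i \<le> 1" "\<And>s. h s \<le> k s"
  shows "bern_expect I p h \<le> bern_expect I p k"
  unfolding bern_expect_def using assms
  by (intro sum_mono mult_left_mono mult_nonneg_nonneg prod_nonneg) auto

lemma bern_expect_const: "finite I \<Longrightarrow> bern_expect I p (\<lambda>_. c) = c"
  by (induction I rule: finite_induct)
    (auto simp: bern_expect_empty bern_expect_insert algebra_simps)

lemma bern_expect_nonneg:
  assumes "\<And>i. i \<in> I \<Longrightarrow> 0 \<le> p i \<and> p i \<le> 1" "\<And>s. 0 \<le> h s"
  shows "0 \<le> bern_expect I p h"
  using bern_expect_mono[of I p "\<lambda>_. 0" h] assms by (simp add: bern_expect_def)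

lemma bern_expect_mono_prob:
  assumes "finite I" "\<And>i. i \<in> I \<Longrightarrow> 0 \<le> p i \<and> p i \<le> p' i \<and> p' i \<le> 1" "mono h"
  shows "bern_expect I p h \<le> bern_expect I p' h"
  using assms
proof (induction I arbitrary: h rule: finite_induct)
  case (insert i I)
  have p: "0 \<le> p i" "p i \<le> p' i" "p' i \<le> 1" using insert.prems(1)[of i] by auto
  let ?A = "bern_expect I p' (\<lambda>s. h (Suc s))" and ?B = "bern_expect I p' h"
  have "mono (\<lambda>s. h (Suc s))" using insert.prems(2) by (auto simp: mono_def)
  then have IH1: "bern_expect I p (\<lambda>s. h (Suc s)) \<le> ?A"
    using insert.prems(1) by (intro insert.IH) auto
  have IH2: "bern_expect I p h \<le> ?B" using insert.prems by (intro insert.IH) auto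
  have "bern_expect (insert i I) p h \<le> p i * ?A + (1 - p i) * ?B"
    unfolding bern_expect_insert[OF insert.hyps]
    using p IH1 IH2 by (intro add_mono mult_left_mono) auto
  also have "\<dots> = p i * (?A - ?B) + ?B" by (simp add: algebra_simps)
  also have "\<dots> \<le> p' i * (?A - ?B) + ?B"
  proof (intro add_right_mono mult_right_mono)
    have "?B \<le> ?A"
    proof (rule bern_expect_mono)
      show "0 \<le> p' k \<and> p' k \<le> 1" if "k \<in> I" for k
        using insert.prems(1)[of k] that by auto
      show "h s \<le> h (Suc s)" for s using insert.prems(2) by (simp add: mono_def)
    qed
    then show "0 \<le> ?A - ?B" by simp
  qed (use p in auto)
  also have "\<dots> = bern_expect (insert i I) p' h"
    unfolding bern_expect_insert[OF insert.hyps] by (simp add: algebra_simps)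
  finally show ?case .
qed (simp add: bern_expect_empty)

text \<open>
  The expectation is affine in each success probability, with slope the expected gain from a success
  in that trial.
\<close>

lemma bern_expect_has_derivative:
  assumes "finite I" "\<And>i. i \<in> I \<Longrightarrow> ((\<lambda>t. p t i) has_real_derivative p' i) (at t)"
  shows "((\<lambda>t. bern_expect I (p t) h) has_real_derivative
    (\<Sum>i\<in>I. p' i * bern_expect (I - {i}) (p t) (\<lambda>s. h (Suc s) - h s))) (at t)"
  using assms
proof (induction I arbitrary: h rule: finite_induct)
  case (insert i I)
  define D where "D k h = bern_expect (I - {k}) (p t) (\<lambda>s. h (Suc s) - h s)" for k h
  have IH: "((\<lambda>t. bern_expect I (p t) h) has_real_derivative (\<Sum>k\<in>I. p' k * D k h)) (at t)" for h
    unfolding D_def by (rule insert.IH) (use insert.prems in auto)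
  have pi: "((\<lambda>t. p t i) has_real_derivative p' i) (at t)" using insert.prems by simp
  have "((\<lambda>t. p t i * bern_expect I (p t) (\<lambda>s. h (Suc s)) + (1 - p t i) * bern_expect I (p t) h)
    has_real_derivative (p' i * bern_expect I (p t) (\<lambda>s. h (Suc s))
        + (\<Sum>k\<in>I. p' k * D k (\<lambda>s. h (Suc s))) * p t i)
      + ((0 - p' i) * bern_expect I (p t) h + (\<Sum>k\<in>I. p' k * D k h) * (1 - p t i))) (at t)"
    by (intro DERIV_add DERIV_mult DERIV_diff DERIV_const pi IH)
  then have deriv: "((\<lambda>t. bern_expect (insert i I) (p t) h) has_real_derivative
      p' i * bern_expect I (p t) (\<lambda>s. h (Suc s) - h s)
      + ((\<Sum>k\<in>I. p' k * D k (\<lambda>s. h (Suc s))) * p t i + (\<Sum>k\<in>I. p' k * D k h) * (1 - p t i))) (at t)"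
    unfolding bern_expect_insert[OF insert.hyps] bern_expect_diff by (simp add: algebra_simps)
  have split: "bern_expect (insert i I - {k}) (p t) (\<lambda>s. h (Suc s) - h s)
      = p t i * D k (\<lambda>s. h (Suc s)) + (1 - p t i) * D k h" if "k \<in> I" for k
  proof -
    have "insert i I - {k} = insert i (I - {k})" using that insert.hyps by auto
    then show ?thesis
      unfolding D_def using insert.hyps by (simp add: bern_expect_insert)
  qed
  then have "(\<Sum>k\<in>I. p' k * bern_expect (insert i I - {k}) (p t) (\<lambda>s. h (Suc s) - h s))
      = (\<Sum>k\<in>I. p' k * D k (\<lambda>s. h (Suc s)) * p t i + p' k * D k h * (1 - p t i))"
    by (intro sum.cong refl) (simp only: split distrib_left mult_ac)
  then have "(\<Sum>k\<in>I. p' k * bern_expect (insert i I - {k}) (p t) (\<lambda>s. h (Suc s) - h s))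
      = (\<Sum>k\<in>I. p' k * D k (\<lambda>s. h (Suc s))) * p t i + (\<Sum>k\<in>I. p' k * D k h) * (1 - p t i)"
    by (simp only: sum_distrib_right sum.distrib)
  moreover have "insert i I - {i} = I" using insert.hyps by auto
  ultimately show ?case
    using deriv by (simp only: sum.insert[OF insert.hyps])
qed (simp add: bern_expect_empty)

lemma bern_expect_square_deviation:
  assumes "finite I"
  shows "bern_expect I p (\<lambda>s. (real s - x)\<^sup>2) = (\<Sum>i\<in>I. p i * (1 - p i)) + ((\<Sum>i\<in>I. p i) - x)\<^sup>2"
  using assms
proof (induction I arbitrary: x rule: finite_induct)
  case (insert i I)
  have "bern_expect I p (\<lambda>s. (real (Suc s) - x)\<^sup>2) = bern_expect I p (\<lambda>s. (real s - (x - 1))\<^sup>2)"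
    by (rule bern_expect_cong) (auto simp: algebra_simps)
  then have "bern_expect (insert i I) p (\<lambda>s. (real s - x)\<^sup>2)
      = p i * bern_expect I p (\<lambda>s. (real s - (x - 1))\<^sup>2)
        + (1 - p i) * bern_expect I p (\<lambda>s. (real s - x)\<^sup>2)"
    by (simp only: bern_expect_insert[OF insert.hyps])
  then show ?case
    unfolding insert.IH using insert.hyps by (simp add: power2_eq_square algebra_simps)
qed (simp add: bern_expect_empty power2_commute)

lemma bern_expect_variance_le:
  assumes "finite I"
  shows "bern_expect I p (\<lambda>s. (real s - (\<Sum>i\<in>I. p i))\<^sup>2) \<le> real (card I) / 4"
proof -
  have "p i * (1 - p i) \<le> 1/4" for i
    using zero_le_power2[of "p i - 1/2"] by (simp add: power2_eq_square algebra_simps)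
  then have "(\<Sum>i\<in>I. p i * (1 - p i)) \<le> (\<Sum>i\<in>I. 1/4)" by (intro sum_mono)
  then show ?thesis by (simp add: bern_expect_square_deviation[OF assms])
qed

text \<open>
  Chebyshev's inequality, each trial having variance at most \<open>1/4\<close>.
\<close>

lemma bern_tail_le:
  assumes "finite I" "\<And>i. i \<in> I \<Longrightarrow> 0 \<le> p i \<and> p i \<le> 1" "0 < d" "(\<Sum>i\<in>I. p i) + d \<le> real j"
  shows "bern_expect I p (\<lambda>s. of_bool (j \<le> s)) \<le> real (card I) / (4 * d\<^sup>2)"
proof -
  let ?M = "\<Sum>i\<in>I. p i"
  have "bern_expect I p (\<lambda>s. of_bool (j \<le> s)) \<le> bern_expect I p (\<lambda>s. 1 / d\<^sup>2 * (real s - ?M)\<^sup>2)"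
  proof (rule bern_expect_mono)
    show "of_bool (j \<le> s) \<le> 1 / d\<^sup>2 * (real s - ?M)\<^sup>2" for s
    proof (cases "j \<le> s")
      case True
      then have "d\<^sup>2 \<le> (real s - ?M)\<^sup>2" using assms(3,4) by (intro power_mono) auto
      then show ?thesis using True \<open>0 < d\<close> by simp
    qed simp
  qed (use assms in auto)
  also have "\<dots> = 1 / d\<^sup>2 * bern_expect I p (\<lambda>s. (real s - ?M)\<^sup>2)" by (rule bern_expect_cmult)
  also have "\<dots> \<le> 1 / d\<^sup>2 * (real (card I) / 4)"
    by (intro mult_left_mono bern_expect_variance_le assms(1)) simp
  finally show ?thesis by simp
qed

lemma bern_tail_ge:
  assumes "finite I" "\<And>i. i \<in> I \<Longrightarrow> 0 \<le> p i \<and> p i \<le> 1" "0 < d" "real j + d \<le> (\<Sum>i\<in>I. p i)"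
  shows "1 - real (card I) / (4 * d\<^sup>2) \<le> bern_expect I p (\<lambda>s. of_bool (j \<le> s))"
proof -
  let ?M = "\<Sum>i\<in>I. p i"
  have "1 - real (card I) / (4 * d\<^sup>2) = 1 - 1 / d\<^sup>2 * (real (card I) / 4)" by simp
  also have "\<dots> \<le> 1 - 1 / d\<^sup>2 * bern_expect I p (\<lambda>s. (real s - ?M)\<^sup>2)"
    by (intro diff_left_mono mult_left_mono bern_expect_variance_le assms(1)) simp
  also have "\<dots> = bern_expect I p (\<lambda>s. 1 - 1 / d\<^sup>2 * (real s - ?M)\<^sup>2)"
    by (simp only: bern_expect_diff bern_expect_cmult bern_expect_const[OF assms(1)])
  also have "\<dots> \<le> bern_expect I p (\<lambda>s. of_bool (j \<le> s))"
  proof (rule bern_expect_mono)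
    show "1 - 1 / d\<^sup>2 * (real s - ?M)\<^sup>2 \<le> of_bool (j \<le> s)" for s
    proof (cases "j \<le> s")
      case False
      then have "d\<^sup>2 \<le> (?M - real s)\<^sup>2" using assms(3,4) by (intro power_mono) auto
      then show ?thesis using False \<open>0 < d\<close> by (simp add: power2_commute)
    qed simp
  qed (use assms in auto)
  finally show ?thesis .
qed

lemma bern_expect_0_1:
  assumes "finite I" "\<And>i. i \<in> I \<Longrightarrow> p i = 0 \<or> p i = 1"
  shows "bern_expect I p h = h (card {i \<in> I. p i = 1})"
  using assms
proof (induction I arbitrary: h rule: finite_induct)
  case (insert i I)
  have "{k \<in> insert i I. p k = 1} = (if p i = 1 then insert i {k \<in> I. p k = 1} else {k \<in> I. p k = 1})"
    by auto
  then show ?case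
    using insert.hyps insert.IH insert.prems
    by (cases "p i = 0") (auto simp: bern_expect_insert)
qed (simp add: bern_expect_empty)

section \<open>Spreading of the number of ones by one flip of the center\<close>

context star_model
begin

text \<open>
  The law of the number of ones after the leaves have evolved independently from \<open>\<eta>\<close>: a leaf that
  started in state \<open>e\<close> is 1 with probability \<open>a + b e\<close>.
\<close>

definition leaf_expect :: "real \<Rightarrow> real \<Rightarrow> (nat \<Rightarrow> real) \<Rightarrow> (star_vertex \<Rightarrow> nat) \<Rightarrow> real" where
  "leaf_expect a b h \<eta> = bern_expect (leaves n) (\<lambda>x. a + b * real (\<eta> x)) h"

text \<open>
  The expected change of \<open>h\<close> when leaf \<open>x\<close> turns from 0 to 1, the other leaves being distributed as
  in \<open>leaf_expect\<close>.
\<close>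

definition leaf_pivot :: "real \<Rightarrow> real \<Rightarrow> (nat \<Rightarrow> real) \<Rightarrow> (star_vertex \<Rightarrow> nat) \<Rightarrow> star_vertex \<Rightarrow> real" where
  "leaf_pivot a b h \<eta> x
    = bern_expect (leaves n - {x}) (\<lambda>x. a + b * real (\<eta> x)) (\<lambda>s. h (Suc s) - h s)"

lemma leaf_prob:
  assumes "0 \<le> a" "0 \<le> b" "a + b \<le> 1" "\<eta> \<in> \<Omega>" "x \<in> leaves n"
  shows "0 \<le> a + b * real (\<eta> x) \<and> a + b * real (\<eta> x) \<le> 1"
  using config_leaf[OF assms(4,5)] assms by auto

lemma leaf_expect_flip_Center: "leaf_expect a b h (flip \<eta> Center) = leaf_expect a b h \<eta>"
  unfolding leaf_expect_def using Center_notin_leaves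
  by (intro bern_expect_cong) (auto simp: flip_def)

lemma leaf_expect_flip_leaf:
  assumes "\<eta> \<in> \<Omega>" "x \<in> leaves n"
  shows "leaf_expect a b h (flip \<eta> x) - leaf_expect a b h \<eta>
    = b * (1 - 2 * real (\<eta> x)) * leaf_pivot a b h \<eta> x"
proof -
  have "bern_expect (leaves n - {x}) (\<lambda>y. a + b * real (flip \<eta> x y)) k
      = bern_expect (leaves n - {x}) (\<lambda>y. a + b * real (\<eta> y)) k" for k
    by (intro bern_expect_cong) (auto simp: flip_other)
  then show ?thesis
    using config_leaf[OF assms] finite_leaves assms(2)
    by (auto simp: leaf_expect_def leaf_pivot_def bern_expect_remove[of _ x] bern_expect_diff
        flip_same algebra_simps)
qed

text \<open>
  While the center is fixed, the generator acts on \<open>leaf_expect\<close> as a drift of the parameters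
  \<open>a\<close> and \<open>b\<close>. The next lemma says that \<open>a' = c b\<close> and \<open>b' = - 2 b\<close> follow this drift, where
  \<open>c\<close> is \<open>1/2\<close> plus the state of the center.
\<close>

lemma gen_leaves_leaf_expect:
  assumes "\<eta> \<in> \<Omega>"
  shows "(\<Sum>x\<in>leaves n. rate \<eta> x * (leaf_expect a b h (flip \<eta> x) - leaf_expect a b h \<eta>))
    = (\<Sum>x\<in>leaves n. b * (1/2 + real (\<eta> Center) - 2 * real (\<eta> x)) * leaf_pivot a b h \<eta> x)"
proof (rule sum.cong)
  fix x assume x: "x \<in> leaves n"
  show "rate \<eta> x * (leaf_expect a b h (flip \<eta> x) - leaf_expect a b h \<eta>)
      = b * (1/2 + real (\<eta> Center) - 2 * real (\<eta> x)) * leaf_pivot a b h \<eta> x"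
    unfolding leaf_expect_flip_leaf[OF assms x] leaf_drift[OF assms x, symmetric]
    by (simp only: mult_ac)
qed simp

lemma leaf_expect_has_derivative:
  assumes "(a has_real_derivative c * b t) (at t)" "(b has_real_derivative - 2 * b t) (at t)"
  shows "((\<lambda>t. leaf_expect (a t) (b t) h \<eta>) has_real_derivative
    (\<Sum>x\<in>leaves n. b t * (c - 2 * real (\<eta> x)) * leaf_pivot (a t) (b t) h \<eta> x)) (at t)"
  unfolding leaf_expect_def leaf_pivot_def
  by (rule bern_expect_has_derivative[OF finite_leaves])
    (auto intro!: derivative_eq_intros assms simp: algebra_simps)

text \<open>
  For the event of at least \<open>j\<close> ones, leaf \<open>x\<close> is pivotal iff the other leaves have \<open>j - 1\<close> ones. With
  probability at least \<open>a\<close> the leaf is then 1, which gives exactly \<open>j\<close> ones. So \<open>a\<close> times the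
  probability of being pivotal is at most the probability of exactly \<open>j\<close> ones, for each of the
  \<open>n\<close> leaves.
\<close>

lemma sum_leaf_pivot_le:
  assumes ab: "0 \<le> a" "0 \<le> b" "a + b \<le> 1" and c: "0 \<le> c" "c * real n \<le> a / 2" and \<eta>: "\<eta> \<in> \<Omega>"
  shows "c * (\<Sum>x\<in>leaves n. leaf_pivot a b (\<lambda>s. of_bool (j \<le> s)) \<eta> x)
    \<le> 1/2 * leaf_expect a b (\<lambda>s. of_bool (s = j)) \<eta>"
proof -
  let ?p = "\<lambda>x. a + b * real (\<eta> x)" and ?Z = "leaf_expect a b (\<lambda>s. of_bool (s = j)) \<eta>"
  have pivot: "0 \<le> leaf_pivot a b (\<lambda>s. of_bool (j \<le> s)) \<eta> x
      \<and> a * leaf_pivot a b (\<lambda>s. of_bool (j \<le> s)) \<eta> x \<le> ?Z" if x: "x \<in> leaves n" for x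
  proof -
    have p: "0 \<le> ?p y \<and> ?p y \<le> 1" if "y \<in> leaves n" for y by (rule leaf_prob[OF ab \<eta> that])
    define D where "D = bern_expect (leaves n - {x}) ?p (\<lambda>s. of_bool (Suc s = j))"
    have "leaf_pivot a b (\<lambda>s. of_bool (j \<le> s)) \<eta> x = D"
      unfolding leaf_pivot_def D_def by (rule bern_expect_cong) auto
    moreover have "0 \<le> D" unfolding D_def using p by (intro bern_expect_nonneg) auto
    moreover have "a * D \<le> ?Z"
    proof -
      have "a * D \<le> ?p x * D" using \<open>0 \<le> D\<close> ab(2) by (intro mult_right_mono) auto
      also have "\<dots> \<le> ?p x * D + (1 - ?p x) * bern_expect (leaves n - {x}) ?p (\<lambda>s. of_bool (s = j))"
      proof -
        have "0 \<le> bern_expect (leaves n - {x}) ?p (\<lambda>s. of_bool (s = j))"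
          using p by (intro bern_expect_nonneg) auto
        then show ?thesis using p[OF x] by simp
      qed
      also have "\<dots> = ?Z"
        unfolding leaf_expect_def D_def using bern_expect_remove[OF finite_leaves x] by simp
      finally show ?thesis .
    qed
    ultimately show ?thesis by simp
  qed
  have "real n * (c * leaf_pivot a b (\<lambda>s. of_bool (j \<le> s)) \<eta> x) \<le> 1/2 * ?Z" if x: "x \<in> leaves n" for x
  proof -
    have "real n * (c * leaf_pivot a b (\<lambda>s. of_bool (j \<le> s)) \<eta> x)
        = (c * real n) * leaf_pivot a b (\<lambda>s. of_bool (j \<le> s)) \<eta> x" by simp
    also have "\<dots> \<le> (a / 2) * leaf_pivot a b (\<lambda>s. of_bool (j \<le> s)) \<eta> x"
      using c(2) pivot[OF x] by (intro mult_right_mono) auto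
    also have "\<dots> \<le> 1/2 * ?Z" using pivot[OF x] by simp
    finally show ?thesis .
  qed
  then have "(\<Sum>x\<in>leaves n. real n * (c * leaf_pivot a b (\<lambda>s. of_bool (j \<le> s)) \<eta> x))
      \<le> (\<Sum>x\<in>leaves n. 1/2 * ?Z)" by (rule sum_mono)
  then have "real n * (c * (\<Sum>x\<in>leaves n. leaf_pivot a b (\<lambda>s. of_bool (j \<le> s)) \<eta> x))
      \<le> real n * (1/2 * ?Z)"
    by (simp add: sum_distrib_left card_leaves)
  then show ?thesis using n_pos by simp
qed

text \<open>
  A lower bound for \<open>g\<close> on configurations with center 0, in terms of the probability of \<open>j\<close> ones,
  is propagated by time \<open>t\<close>. In the parameters, \<open>aL\<close> belongs to a center that stays at 0 and
  \<open>aH\<close> to a center that stays at 1 during this time.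

  With center 0, the bound for \<open>j\<close> ones persists up to the factor \<open>exp (- 3 t / 2)\<close>, the cost of no
  flip of the center. With center 1, the flip to 0 occurs at rate at least \<open>1/2\<close>. Let \<open>G\<close> be
  the difference of the probabilities of at least \<open>j\<close> ones for the two evolutions. Its time derivative
  exceeds the generator of the leaves under center 1, applied to \<open>G\<close>, by at most \<open>b\<close> times the sum of
  the pivotal probabilities, which by \<open>sum_leaf_pivot_le\<close> is controlled by what that flip brings in.
  Thus \<open>\<kappa> G\<close> is a subsolution as soon as \<open>\<kappa> b n \<le> a / 2\<close>. For \<open>\<kappa> = 0\<close> the parameters \<open>a = 0\<close> and \<open>b = 1\<close>
  are allowed, which describe the initial configuration itself.
\<close>

lemma phase_lower_bound:
  assumes ab: "0 \<le> a" "0 \<le> b" "a + b \<le> 1"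
    and \<kappa>: "0 \<le> \<kappa>" "\<kappa> * b * real n \<le> a / 2" and \<theta>: "0 \<le> \<theta>"
    and g: "\<And>\<xi>. \<xi> \<in> \<Omega> \<Longrightarrow> 0 \<le> g \<xi>"
      "\<And>\<xi>. \<xi> \<in> \<Omega> \<Longrightarrow> \<xi> Center = 0 \<Longrightarrow> \<theta> * leaf_expect a b (\<lambda>s. of_bool (s = j)) \<xi> \<le> g \<xi>"
    and t: "0 \<le> t" and \<eta>: "\<eta> \<in> \<Omega>"
  defines "b' \<equiv> b * exp (- 2 * t)"
    and "aL \<equiv> a + b / 4 * (1 - exp (- 2 * t))"
    and "aH \<equiv> a + 3 * b / 4 * (1 - exp (- 2 * t))"
  shows "\<eta> Center = 0 \<Longrightarrow>
      \<theta> * exp (- 3/2 * t) * leaf_expect aL b' (\<lambda>s. of_bool (s = j)) \<eta> \<le> expect t g \<eta>"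
    and "\<eta> Center = 1 \<Longrightarrow>
      \<theta> * exp (- 3/2 * t) * (\<kappa> * (leaf_expect aH b' (\<lambda>s. of_bool (j \<le> s)) \<eta>
        - leaf_expect aL b' (\<lambda>s. of_bool (j \<le> s)) \<eta>)) \<le> expect t g \<eta>"
proof -
  let ?eq = "\<lambda>s. of_bool (s = j) :: real" and ?ge = "\<lambda>s. of_bool (j \<le> s) :: real"
  define B where "B t = b * exp (- 2 * t)" for t
  define L where "L t = a + b / 4 * (1 - exp (- 2 * t))" for t
  define H where "H t = a + 3 * b / 4 * (1 - exp (- 2 * t))" for t
  define Z where "Z t \<xi> = leaf_expect (L t) (B t) ?eq \<xi>" for t \<xi>
  define G where "G t \<xi> = leaf_expect (H t) (B t) ?ge \<xi> - leaf_expect (L t) (B t) ?ge \<xi>" for t \<xi>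
  define drift where "drift c a b h \<xi> = (\<Sum>x\<in>leaves n. b * (c - 2 * real (\<xi> x)) * leaf_pivot a b h \<xi> x)"
    for c a b h \<xi>
  define v where "v t \<xi> = \<theta> * exp (- 3/2 * t) * (if \<xi> Center = 0 then Z t \<xi> else \<kappa> * G t \<xi>)" for t \<xi>
  define v' where "v' t \<xi> = \<theta> * exp (- 3/2 * t) * (if \<xi> Center = 0
    then drift (1/2) (L t) (B t) ?eq \<xi> - 3/2 * Z t \<xi>
    else \<kappa> * (drift (3/2) (H t) (B t) ?ge \<xi> - drift (1/2) (L t) (B t) ?ge \<xi>) - 3/2 * (\<kappa> * G t \<xi>))" for t \<xi>
  have B_deriv: "(B has_real_derivative - 2 * B t) (at t)" for t
    unfolding B_def by (auto intro!: derivative_eq_intros)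
  have L_deriv: "(L has_real_derivative 1/2 * B t) (at t)" for t
    unfolding B_def L_def by (auto intro!: derivative_eq_intros)
  have H_deriv: "(H has_real_derivative 3/2 * B t) (at t)" for t
    unfolding B_def H_def by (auto intro!: derivative_eq_intros)
  have bounds: "0 \<le> L t" "a \<le> L t" "0 \<le> B t" "B t \<le> b" "L t \<le> H t" "H t + B t \<le> 1" if "0 \<le> t" for t
  proof -
    define e where "e = exp (- 2 * t)"
    have e: "0 \<le> e" "e \<le> 1" using that by (auto simp: e_def)
    have b1: "0 \<le> b * (1 - e)" "0 \<le> b * e" using ab(2) e by auto
    show "0 \<le> B t" "B t \<le> b" unfolding B_def e_def[symmetric] using b1 by (auto simp: algebra_simps)
    define y where "y = b * e"
    have y: "0 \<le> y" "y \<le> b" using b1 by (auto simp: y_def algebra_simps)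
    have eqs: "B t = y" "L t = a + (b - y) / 4" "H t = a + 3 * (b - y) / 4"
      unfolding B_def L_def H_def e_def[symmetric] y_def by (simp_all add: field_simps)
    show "0 \<le> L t" "a \<le> L t" "L t \<le> H t" using y ab by (simp_all add: eqs)
    have "3 * (b - y) / 4 + y \<le> b" using y by (simp add: field_simps)
    then show "H t + B t \<le> 1" using ab by (simp add: eqs)
  qed
  have exp_deriv: "((\<lambda>t. \<theta> * exp (- 3/2 * t)) has_real_derivative - 3/2 * (\<theta> * exp (- 3/2 * t))) (at t)" for t
    by (auto intro!: derivative_eq_intros)
  have main: "v t \<eta> \<le> expect t g \<eta>"
  proof (rule subsolution_le_expect[where v' = v'])
    fix t \<xi> assume t: "0 \<le> (t::real)" and \<xi>: "\<xi> \<in> \<Omega>"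
    note bd = bounds[OF t]
    let ?e = "\<theta> * exp (- 3/2 * t)"
    have e0: "0 \<le> ?e" using \<theta> by simp
    have Z_nonneg: "0 \<le> Z t \<xi>"
      unfolding Z_def leaf_expect_def
      by (intro bern_expect_nonneg leaf_prob \<xi>) (use bd in auto)
    have G_nonneg: "0 \<le> G t \<xi>"
    proof -
      have "0 \<le> L t + B t * real (\<xi> x) \<and> L t + B t * real (\<xi> x) \<le> H t + B t * real (\<xi> x)
          \<and> H t + B t * real (\<xi> x) \<le> 1" if "x \<in> leaves n" for x
        using leaf_prob[of "L t" "B t" \<xi> x] leaf_prob[of "H t" "B t" \<xi> x] bd \<xi> that by auto
      moreover have "mono ?ge" by (auto simp: mono_def)
      ultimately have "leaf_expect (L t) (B t) ?ge \<xi> \<le> leaf_expect (H t) (B t) ?ge \<xi>"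
        unfolding leaf_expect_def by (intro bern_expect_mono_prob finite_leaves) auto
      then show ?thesis by (simp add: G_def)
    qed
    have Z_deriv: "((\<lambda>t. Z t \<xi>) has_real_derivative drift (1/2) (L t) (B t) ?eq \<xi>) (at t)"
      unfolding Z_def drift_def by (rule leaf_expect_has_derivative[OF L_deriv B_deriv])
    have G_deriv: "((\<lambda>t. G t \<xi>) has_real_derivative
        drift (3/2) (H t) (B t) ?ge \<xi> - drift (1/2) (L t) (B t) ?ge \<xi>) (at t)"
      unfolding G_def drift_def
      by (intro DERIV_diff leaf_expect_has_derivative H_deriv L_deriv B_deriv)
    show "((\<lambda>t. v t \<xi>) has_real_derivative v' t \<xi>) (at t)"
    proof (cases "\<xi> Center = 0")
      case True
      show ?thesis
        unfolding v_def v'_def using True DERIV_mult[OF exp_deriv Z_deriv] by (simp add: algebra_simps)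
    next
      case False
      show ?thesis
        unfolding v_def v'_def
        using False DERIV_mult[OF exp_deriv DERIV_cmult[OF G_deriv, of \<kappa>]] by (simp add: algebra_simps)
    qed
    have flip_Center: "Z t (flip \<xi> Center) = Z t \<xi>" "G t (flip \<xi> Center) = G t \<xi>"
      by (simp_all add: Z_def G_def leaf_expect_flip_Center)
    have flip_leaf: "flip \<xi> x Center = \<xi> Center" if "x \<in> leaves n" for x
      using that Center_notin_leaves by (auto simp: flip_def)
    note rate = rate_Center_bounds[OF \<xi>]
    show "v' t \<xi> \<le> gen (v t) \<xi>"
    proof (cases "\<xi> Center = 0")
      case True
      have "(\<Sum>x\<in>leaves n. rate \<xi> x * (v t (flip \<xi> x) - v t \<xi>))
          = ?e * (\<Sum>x\<in>leaves n. rate \<xi> x * (Z t (flip \<xi> x) - Z t \<xi>))"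
        unfolding sum_distrib_left v_def using True flip_leaf
        by (intro sum.cong) (auto simp: algebra_simps)
      also have "\<dots> = ?e * drift (1/2) (L t) (B t) ?eq \<xi>"
        unfolding Z_def gen_leaves_leaf_expect[OF \<xi>] drift_def using True by simp
      finally have "gen (v t) \<xi> = rate \<xi> Center * (?e * (\<kappa> * G t \<xi> - Z t \<xi>))
          + ?e * drift (1/2) (L t) (B t) ?eq \<xi>"
        by (simp add: gen_star[OF \<xi>] v_def True flip_same flip_Center right_diff_distrib)
      moreover have "- 3/2 * (?e * Z t \<xi>) \<le> rate \<xi> Center * (?e * (\<kappa> * G t \<xi> - Z t \<xi>))"
      proof -
        have "rate \<xi> Center * (?e * Z t \<xi>) \<le> 3/2 * (?e * Z t \<xi>)"
          using rate Z_nonneg e0 by (intro mult_right_mono) auto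
        moreover have "0 \<le> rate \<xi> Center * (?e * (\<kappa> * G t \<xi>))"
          using rate G_nonneg \<theta> \<kappa>(1) by (intro mult_nonneg_nonneg) auto
        ultimately show ?thesis by (simp add: right_diff_distrib)
      qed
      moreover have "v' t \<xi> = ?e * drift (1/2) (L t) (B t) ?eq \<xi> - 3/2 * (?e * Z t \<xi>)"
        by (simp add: v'_def True right_diff_distrib)
      ultimately show ?thesis by linarith
    next
      case False
      then have one: "\<xi> Center = 1" using config_Center[OF \<xi>] by auto
      have "(\<Sum>x\<in>leaves n. rate \<xi> x * (v t (flip \<xi> x) - v t \<xi>))
          = ?e * \<kappa> * (\<Sum>x\<in>leaves n. rate \<xi> x * (G t (flip \<xi> x) - G t \<xi>))"
        unfolding sum_distrib_left v_def using one flip_leaf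
        by (intro sum.cong) (auto simp: algebra_simps)
      also have "(\<Sum>x\<in>leaves n. rate \<xi> x * (G t (flip \<xi> x) - G t \<xi>))
          = drift (3/2) (H t) (B t) ?ge \<xi> - drift (3/2) (L t) (B t) ?ge \<xi>"
      proof -
        have "(\<Sum>x\<in>leaves n. rate \<xi> x * (G t (flip \<xi> x) - G t \<xi>))
          = (\<Sum>x\<in>leaves n. rate \<xi> x * (leaf_expect (H t) (B t) ?ge (flip \<xi> x) - leaf_expect (H t) (B t) ?ge \<xi>))
          - (\<Sum>x\<in>leaves n. rate \<xi> x * (leaf_expect (L t) (B t) ?ge (flip \<xi> x) - leaf_expect (L t) (B t) ?ge \<xi>))"
          unfolding sum_subtractf[symmetric] G_def by (intro sum.cong) (auto simp: algebra_simps)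
        then show ?thesis unfolding gen_leaves_leaf_expect[OF \<xi>] drift_def using one by simp
      qed
      \<comment> \<open>the function for center 0 is moved by the generator for center 1; the excess is the pivotal sum\<close>
      also have "drift (3/2) (L t) (B t) ?ge \<xi> = drift (1/2) (L t) (B t) ?ge \<xi>
          + B t * (\<Sum>x\<in>leaves n. leaf_pivot (L t) (B t) ?ge \<xi> x)"
        unfolding drift_def sum_distrib_left sum.distrib[symmetric]
        by (intro sum.cong) (auto simp: algebra_simps)
      finally have "gen (v t) \<xi> = rate \<xi> Center * (?e * (Z t \<xi> - \<kappa> * G t \<xi>))
          + ?e * \<kappa> * (drift (3/2) (H t) (B t) ?ge \<xi> - drift (1/2) (L t) (B t) ?ge \<xi>)
          - ?e * (\<kappa> * B t * (\<Sum>x\<in>leaves n. leaf_pivot (L t) (B t) ?ge \<xi> x))"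
        by (simp add: gen_star[OF \<xi>] v_def one flip_same flip_Center algebra_simps)
      moreover have "?e * (\<kappa> * B t * (\<Sum>x\<in>leaves n. leaf_pivot (L t) (B t) ?ge \<xi> x)) \<le> ?e * (1/2 * Z t \<xi>)"
      proof (rule mult_left_mono[OF _ e0])
        have "\<kappa> * B t * real n \<le> \<kappa> * b * real n"
          using bd(4) \<kappa>(1) by (intro mult_right_mono mult_left_mono) auto
        also have "\<dots> \<le> L t / 2" using \<kappa>(2) bd(2) by simp
        finally show "\<kappa> * B t * (\<Sum>x\<in>leaves n. leaf_pivot (L t) (B t) ?ge \<xi> x) \<le> 1/2 * Z t \<xi>"
          unfolding Z_def using bd \<kappa>(1) by (intro sum_leaf_pivot_le \<xi>) auto
      qed
      moreover have "?e * (1/2 * Z t \<xi>) - 3/2 * (?e * (\<kappa> * G t \<xi>))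
          \<le> rate \<xi> Center * (?e * (Z t \<xi> - \<kappa> * G t \<xi>))"
      proof -
        have "rate \<xi> Center * (?e * (\<kappa> * G t \<xi>)) \<le> 3/2 * (?e * (\<kappa> * G t \<xi>))"
          using rate G_nonneg e0 \<kappa>(1) by (intro mult_right_mono) auto
        moreover have "1/2 * (?e * Z t \<xi>) \<le> rate \<xi> Center * (?e * Z t \<xi>)"
          using rate Z_nonneg e0 by (intro mult_right_mono) auto
        ultimately show ?thesis by (simp add: right_diff_distrib)
      qed
      moreover have "v' t \<xi> = ?e * \<kappa> * (drift (3/2) (H t) (B t) ?ge \<xi> - drift (1/2) (L t) (B t) ?ge \<xi>)
          - 3/2 * (?e * (\<kappa> * G t \<xi>))"
        by (simp add: v'_def one right_diff_distrib)
      ultimately show ?thesis by linarith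
    qed
  next
    fix \<xi> assume \<xi>: "\<xi> \<in> \<Omega>"
    show "v 0 \<xi> \<le> g \<xi>"
      using g[OF \<xi>] by (simp add: v_def Z_def G_def L_def H_def B_def)
  qed (use t \<eta> in auto)
  show "\<theta> * exp (- 3/2 * t) * leaf_expect aL b' ?eq \<eta> \<le> expect t g \<eta>" if "\<eta> Center = 0"
    using main that by (simp add: v_def Z_def L_def B_def aL_def b'_def)
  show "\<theta> * exp (- 3/2 * t) * (\<kappa> * (leaf_expect aH b' ?ge \<eta> - leaf_expect aL b' ?ge \<eta>))
      \<le> expect t g \<eta>" if "\<eta> Center = 1"
    using main that by (simp add: v_def G_def L_def H_def B_def aL_def aH_def b'_def)
qed

end

text \<open>
  In this time the memory \<open>exp (- 2 t)\<close> of a leaf is halved.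
\<close>

definition half_time :: real where "half_time = ln 2 / 2"

lemma half_time: "0 < half_time" "exp (- 2 * half_time) = 1/2"
  by (simp_all add: half_time_def exp_minus)

context star_model
begin

text \<open>
  Rerandomization brings the center to 1 whatever the leaves do.
\<close>

lemma expect_Center_ge:
  assumes "\<eta> \<in> \<Omega>" "0 \<le> t"
  shows "(1 - exp (- 2 * t)) / 4 \<le> expect t (\<lambda>\<xi>. real (\<xi> Center)) \<eta>"
proof -
  define v where "v t \<xi> = exp (- 2 * t) * real (\<xi> Center) + 1/4 * (1 - exp (- 2 * t))"
    for t and \<xi> :: "star_vertex \<Rightarrow> nat"
  have "v t \<eta> \<le> expect t (\<lambda>\<xi>. real (\<xi> Center)) \<eta>"
  proof (rule subsolution_le_expect[where v' = "\<lambda>t \<xi>. exp (- 2 * t) * (1/2 - 2 * real (\<xi> Center))"])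
    show "((\<lambda>t. v t \<xi>) has_real_derivative exp (- 2 * t) * (1/2 - 2 * real (\<xi> Center))) (at t)" for t \<xi>
      unfolding v_def by (auto intro!: derivative_eq_intros simp: algebra_simps)
    show "exp (- 2 * t) * (1/2 - 2 * real (\<xi> Center)) \<le> gen (v t) \<xi>" if \<xi>: "\<xi> \<in> \<Omega>" for t \<xi>
    proof -
      have "(\<Sum>x\<in>leaves n. rate \<xi> x * (real (flip \<xi> x Center) - real (\<xi> Center))) = 0"
        using Center_notin_leaves by (intro sum.neutral) (auto simp: flip_def)
      then have "gen (\<lambda>\<xi>. real (\<xi> Center)) \<xi> = rate \<xi> Center * (1 - 2 * real (\<xi> Center))"
        using config_Center[OF \<xi>] by (auto simp: gen_star[OF \<xi>] flip_same)
      also have "\<dots> \<ge> 1/2 - 2 * real (\<xi> Center)"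
        using rate_Center_bounds[OF \<xi>] config_Center[OF \<xi>] by auto
      finally show ?thesis
        unfolding v_def gen_add gen_mult gen_const by simp
    qed
  qed (use assms in \<open>auto simp: v_def\<close>)
  moreover have "(1 - exp (- 2 * t)) / 4 \<le> v t \<eta>" by (simp add: v_def)
  ultimately show ?thesis by linarith
qed

definition leaf_class :: "(star_vertex \<Rightarrow> nat) \<Rightarrow> nat \<times> nat" where
  "leaf_class \<xi> = (\<xi> Center, ones n \<xi>)"

text \<open>
  The expected number of ones is at most \<open>35 n / 128\<close> for the parameter \<open>31/128\<close> and at least
  \<open>61 n / 128\<close> for the parameter \<open>61/128\<close>, while \<open>j\<close> lies between \<open>40 n / 128\<close> and \<open>56 n / 128\<close>. Both
  deviations are at least \<open>5 n / 128\<close>, and Chebyshev's inequality bounds each tail by \<open>1/4\<close> when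
  \<open>n \<ge> 656\<close>.
\<close>

lemma leaf_expect_separation:
  assumes n: "656 \<le> n" and j: "5 * n \<le> 16 * j" "16 * j \<le> 7 * n" and \<eta>: "\<eta> \<in> \<Omega>"
  shows "1/2 \<le> leaf_expect (61/128) (1/32) (\<lambda>s. of_bool (j \<le> s)) \<eta>
    - leaf_expect (31/128) (1/32) (\<lambda>s. of_bool (j \<le> s)) \<eta>"
proof -
  define d where "d = 5 * real n / 128"
  have d: "0 < d" using n_pos by (simp add: d_def)
  have tail: "real (card (leaves n)) / (4 * d\<^sup>2) \<le> 1/4"
    using n by (simp add: card_leaves d_def power2_eq_square divide_simps)
  have mean: "(\<Sum>x\<in>leaves n. a + b * real (\<eta> x)) = a * real n + b * real (ones n \<eta>)" for a b :: real
    by (simp add: sum.distrib card_leaves sum_distrib_left[symmetric] sum_leaves_ones[OF \<eta>] mult.commute)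
  have k: "0 \<le> real (ones n \<eta>)" "real (ones n \<eta>) \<le> real n" using ones_le[of n \<eta>] by auto
  have rj: "5 * real n \<le> 16 * real j" "16 * real j \<le> 7 * real n" using j by linarith+
  have "1 - real (card (leaves n)) / (4 * d\<^sup>2)
      \<le> leaf_expect (61/128) (1/32) (\<lambda>s. of_bool (j \<le> s)) \<eta>"
    unfolding leaf_expect_def
  proof (rule bern_tail_ge[OF finite_leaves _ d])
    show "real j + d \<le> (\<Sum>x\<in>leaves n. 61/128 + 1/32 * real (\<eta> x))"
      unfolding mean using k rj by (simp add: d_def)
  qed (rule leaf_prob[OF _ _ _ \<eta>]; simp)
  moreover have "leaf_expect (31/128) (1/32) (\<lambda>s. of_bool (j \<le> s)) \<eta>
      \<le> real (card (leaves n)) / (4 * d\<^sup>2)"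
    unfolding leaf_expect_def
  proof (rule bern_tail_le[OF finite_leaves _ d])
    show "(\<Sum>x\<in>leaves n. 31/128 + 1/32 * real (\<eta> x)) + d \<le> real j"
      unfolding mean using k rj by (simp add: d_def)
  qed (rule leaf_prob[OF _ _ _ \<eta>]; simp)
  ultimately show ?thesis using tail by linarith
qed

text \<open>
  Three phases, from the last to the first. During the last one, of length \<open>half_time\<close>, the center stays
  at 0, so that every leaf is 1 with probability at least \<open>1/8\<close>. Before it, in time
  \<open>4 half_time\<close>, the center flips from 1 to 0. In the first, again of length \<open>half_time\<close>, the center
  reaches 1 with probability at least \<open>1/8\<close>.
\<close>

lemma law_class_ge:
  assumes n: "656 \<le> n" and j: "5 * n \<le> 16 * j" "16 * j \<le> 7 * n" and \<eta>: "\<eta> \<in> \<Omega>"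
  shows "exp (- 3/2 * half_time) / (1024 * real n)
    \<le> (\<Sum>\<xi> | \<xi> \<in> \<Omega> \<and> leaf_class \<xi> = (0, j). P (6 * half_time) \<eta> \<xi>)"
proof -
  let ?h = half_time and ?eq = "\<lambda>s. of_bool (s = j) :: real" and ?ge = "\<lambda>s. of_bool (j \<le> s) :: real"
  define \<theta> where "\<theta> = exp (- 3/2 * ?h)"
  define g where "g \<xi> = (of_bool (leaf_class \<xi> = (0, j)) :: real)" for \<xi>
  have \<theta>: "0 \<le> \<theta>" by (simp add: \<theta>_def)
  have h0: "0 \<le> ?h" using half_time(1) by simp
  have e16: "exp (- 2 * (4 * ?h)) = 1/16"
  proof -
    have "exp (- 2 * (4 * ?h)) = exp (real 4 * (- 2 * ?h))" by simp
    also have "\<dots> = exp (- 2 * ?h) ^ 4" by (rule exp_of_nat_mult)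
    finally show ?thesis unfolding half_time(2) by (simp add: power4_eq_xxxx)
  qed
  have e8: "exp (- 3/2 * (4 * ?h)) = 1/8"
  proof -
    have "exp (- 3/2 * (4 * ?h)) = exp (real 3 * (- 2 * ?h))" by simp
    also have "\<dots> = exp (- 2 * ?h) ^ 3" by (rule exp_of_nat_mult)
    finally show ?thesis unfolding half_time(2) by (simp add: power3_eq_cube)
  qed
  have phase1: "\<theta> * leaf_expect (1/8) (1/2) ?eq \<xi> \<le> expect ?h g \<xi>" if \<xi>: "\<xi> \<in> \<Omega>" "\<xi> Center = 0" for \<xi>
  proof -
    have "leaf_expect 0 1 ?eq \<zeta> = of_bool (ones n \<zeta> = j)" if "\<zeta> \<in> \<Omega>" for \<zeta>
      unfolding leaf_expect_def ones_def
      using config_leaf[OF that] by (subst bern_expect_0_1) (auto simp: finite_leaves)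
    then have "1 * leaf_expect 0 1 ?eq \<zeta> \<le> g \<zeta>" if "\<zeta> \<in> \<Omega>" "\<zeta> Center = 0" for \<zeta>
      using that by (simp add: g_def leaf_class_def)
    then have "1 * exp (- 3/2 * ?h) * leaf_expect (0 + 1 / 4 * (1 - exp (- 2 * ?h))) (1 * exp (- 2 * ?h)) ?eq \<xi>
        \<le> expect ?h g \<xi>"
      by (intro phase_lower_bound(1)[where \<kappa> = 0] \<xi> h0) (auto simp: g_def)
    then show ?thesis unfolding half_time(2) by (simp add: \<theta>_def)
  qed
  have g1: "0 \<le> expect ?h g \<xi>" if "\<xi> \<in> \<Omega>" for \<xi>
    unfolding expect_def using law_nonneg[OF h0 that]
    by (intro sum_nonneg mult_nonneg_nonneg) (auto simp: g_def)
  have phase2: "\<theta> / (128 * real n) * real (\<xi> Center) \<le> expect (4 * ?h) (expect ?h g) \<xi>" if \<xi>: "\<xi> \<in> \<Omega>" for \<xi>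
  proof (cases "\<xi> Center = 1")
    case True
    have "\<theta> / (128 * real n) * real (\<xi> Center) = \<theta> * (1/8) * (1 / (8 * real n) * (1/2))"
      using True by simp
    also have "\<dots> \<le> \<theta> * (1/8) * (1 / (8 * real n) *
        (leaf_expect (61/128) (1/32) ?ge \<xi> - leaf_expect (31/128) (1/32) ?ge \<xi>))"
      using leaf_expect_separation[OF n j \<xi>] \<theta> by (intro mult_left_mono) auto
    also have "\<dots> \<le> expect (4 * ?h) (expect ?h g) \<xi>"
    proof -
      have "\<theta> * exp (- 3/2 * (4 * ?h)) * (1 / (8 * real n) *
          (leaf_expect (1/8 + 3 * (1/2) / 4 * (1 - exp (- 2 * (4 * ?h)))) (1/2 * exp (- 2 * (4 * ?h))) ?ge \<xi>
          - leaf_expect (1/8 + 1/2 / 4 * (1 - exp (- 2 * (4 * ?h)))) (1/2 * exp (- 2 * (4 * ?h))) ?ge \<xi>))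
        \<le> expect (4 * ?h) (expect ?h g) \<xi>"
        by (rule phase_lower_bound(2)) (use n_pos phase1 g1 \<theta> \<xi> h0 True in simp_all)
      then show ?thesis unfolding e16 e8 by simp
    qed
    finally show ?thesis .
  next
    case False
    then have "\<xi> Center = 0" using config_Center[OF \<xi>] by auto
    moreover have "0 \<le> expect (4 * ?h) (expect ?h g) \<xi>"
      unfolding expect_def[of "4 * ?h"] using h0 \<xi> g1
      by (intro sum_nonneg mult_nonneg_nonneg law_nonneg) auto
    ultimately show ?thesis by simp
  qed
  have "\<theta> / (1024 * real n) = \<theta> / (128 * real n) * ((1 - exp (- 2 * ?h)) / 4)"
    unfolding half_time(2) by simp
  also have "\<dots> \<le> \<theta> / (128 * real n) * expect ?h (\<lambda>\<xi>. real (\<xi> Center)) \<eta>"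
    using \<theta> by (intro mult_left_mono expect_Center_ge \<eta> h0) auto
  also have "\<dots> = expect ?h (\<lambda>\<xi>. \<theta> / (128 * real n) * real (\<xi> Center)) \<eta>"
    unfolding expect_def sum_distrib_left by (intro sum.cong) (auto simp: mult_ac)
  also have "\<dots> \<le> expect ?h (expect (4 * ?h) (expect ?h g)) \<eta>"
    by (rule expect_mono[OF phase2 h0 \<eta>])
  also have "\<dots> = expect (6 * ?h) g \<eta>"
  proof -
    have "expect (6 * ?h) g \<eta> = expect (?h + 5 * ?h) g \<eta>" by simp
    also have "\<dots> = expect ?h (expect (5 * ?h) g) \<eta>" using h0 \<eta> by (intro expect_add) auto
    also have "\<dots> = expect ?h (expect (4 * ?h) (expect ?h g)) \<eta>"
    proof -
      have "expect (5 * ?h) g \<xi> = expect (4 * ?h) (expect ?h g) \<xi>" if "\<xi> \<in> \<Omega>" for \<xi>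
        using expect_add[of "4 * ?h" ?h \<xi> g] h0 that by simp
      then show ?thesis unfolding expect_def[of ?h] by (intro sum.cong) auto
    qed
    finally show ?thesis by simp
  qed
  also have "\<dots> = (\<Sum>\<xi> | \<xi> \<in> \<Omega> \<and> leaf_class \<xi> = (0, j). P (6 * ?h) \<eta> \<xi>)"
    unfolding expect_def g_def using finite_states
    by (simp add: sum.inter_filter[symmetric] of_bool_def if_distrib cong: if_cong)
  finally show ?thesis by (simp add: \<theta>_def)
qed

end

section \<open>Symmetric measures on the star\<close>

lemma sum_mult_delta:
  fixes f :: "'s \<Rightarrow> real"
  assumes "finite A" "a \<in> A"
  shows "(\<Sum>z\<in>A. f z * of_bool (z = a)) = f a"
proof -
  have "(\<Sum>z\<in>A. f z * of_bool (z = a)) = (\<Sum>z\<in>A. if z = a then f z else 0)"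
    by (rule sum.cong) auto
  then show ?thesis using assms by simp
qed

context star_model
begin

text \<open>
  Invariance under permutations of the leaves, stated through the orbits.
\<close>

definition leaf_symmetric :: "((star_vertex \<Rightarrow> nat) \<Rightarrow> real) \<Rightarrow> bool" where
  "leaf_symmetric v \<longleftrightarrow> (\<forall>\<xi>\<in>\<Omega>. \<forall>\<xi>'\<in>\<Omega>. leaf_class \<xi> = leaf_class \<xi>' \<longrightarrow> v \<xi> = v \<xi>')"

lemma leaf_symmetricD:
  assumes "leaf_symmetric v" "\<xi> \<in> \<Omega>" "\<xi>' \<in> \<Omega>" "leaf_class \<xi> = leaf_class \<xi>'"
  shows "v \<xi> = v \<xi>'"
  using assms unfolding leaf_symmetric_def by blast

lemma leaf_symmetric_cong:
  assumes "leaf_symmetric v" "\<And>\<xi>. \<xi> \<in> \<Omega> \<Longrightarrow> w \<xi> = v \<xi>"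
  shows "leaf_symmetric w"
  unfolding leaf_symmetric_def
proof (intro ballI impI)
  fix \<xi> \<xi>' assume \<xi>: "\<xi> \<in> \<Omega>" "\<xi>' \<in> \<Omega>" "leaf_class \<xi> = leaf_class \<xi>'"
  have "w \<xi> = v \<xi>" by (rule assms(2)[OF \<xi>(1)])
  also have "\<dots> = v \<xi>'" by (rule leaf_symmetricD[OF assms(1) \<xi>])
  also have "\<dots> = w \<xi>'" by (rule assms(2)[OF \<xi>(2), symmetric])
  finally show "w \<xi> = w \<xi>'" .
qed

lemma leaf_symmetricI:
  assumes "\<And>\<xi>. \<xi> \<in> \<Omega> \<Longrightarrow> v \<xi> = V (\<xi> Center) (ones n \<xi>)"
  shows "leaf_symmetric v"
  unfolding leaf_symmetric_def
proof (intro ballI impI)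
  fix \<xi> \<xi>' assume \<xi>: "\<xi> \<in> \<Omega>" "\<xi>' \<in> \<Omega>" and "leaf_class \<xi> = leaf_class \<xi>'"
  then have "\<xi> Center = \<xi>' Center" "ones n \<xi> = ones n \<xi>'" by (simp_all add: leaf_class_def)
  then show "v \<xi> = v \<xi>'" using assms[OF \<xi>(1)] assms[OF \<xi>(2)] by simp
qed

text \<open>
  The explicit function of center and number of ones, for calculations.
\<close>

lemma leaf_symmetricE:
  assumes "leaf_symmetric v"
  obtains V where "\<And>\<xi>. \<xi> \<in> \<Omega> \<Longrightarrow> v \<xi> = V (\<xi> Center) (ones n \<xi>)"
proof -
  define V where "V c k = v (SOME \<xi>. \<xi> \<in> \<Omega> \<and> leaf_class \<xi> = (c, k))" for c k
  have "v \<xi> = V (\<xi> Center) (ones n \<xi>)" if \<xi>: "\<xi> \<in> \<Omega>" for \<xi>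
  proof -
    let ?in_class = "\<lambda>\<zeta>. \<zeta> \<in> \<Omega> \<and> leaf_class \<zeta> = (\<xi> Center, ones n \<xi>)"
    have "?in_class \<xi>" using \<xi> by (simp add: leaf_class_def)
    then have "?in_class (Eps ?in_class)" by (rule someI[where P = ?in_class])
    then have "v \<xi> = v (Eps ?in_class)"
      by (intro leaf_symmetricD[OF assms \<xi>]) (simp_all add: leaf_class_def)
    then show ?thesis unfolding V_def .
  qed
  then show ?thesis by (rule that)
qed

text \<open>
  The generator acting on measures: the flow into \<open>\<xi>\<close> comes from the configurations \<open>flip \<xi> x\<close>, since
  flipping is an involution.
\<close>

lemma generator_adjoint:
  assumes \<xi>: "\<xi> \<in> \<Omega>"
  shows "(\<Sum>z\<in>\<Omega>. v z * generator \<Omega> (voter_rate (star n) (star_rate n)) z \<xi>)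
    = (\<Sum>x\<in>star n. v (flip \<xi> x) * rate (flip \<xi> x) x - v \<xi> * rate \<xi> x)"
proof -
  let ?\<delta> = "\<lambda>z. of_bool (z = \<xi>) :: real"
  have flip_iff: "flip z x = \<xi> \<longleftrightarrow> z = flip \<xi> x" if "z \<in> \<Omega>" "x \<in> star n" for z x
  proof -
    have "flip (flip \<zeta> x) x = \<zeta>" if "\<zeta> \<in> \<Omega>" for \<zeta>
      by (cases rule: configuration_cases[OF that \<open>x \<in> star n\<close>]) (auto simp: flip_def)
    then show ?thesis using \<xi> that(1) by metis
  qed
  have "(\<Sum>z\<in>\<Omega>. v z * generator \<Omega> (voter_rate (star n) (star_rate n)) z \<xi>)
      = (\<Sum>z\<in>\<Omega>. v z * gen ?\<delta> z)"
  proof (rule sum.cong)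
    fix z assume z: "z \<in> \<Omega>"
    have "(\<Sum>y\<in>\<Omega>. generator \<Omega> (voter_rate (star n) (star_rate n)) z y * ?\<delta> y)
        = generator \<Omega> (voter_rate (star n) (star_rate n)) z \<xi>"
      by (rule sum_mult_delta[OF finite_states \<xi>])
    then show "v z * generator \<Omega> (voter_rate (star n) (star_rate n)) z \<xi> = v z * gen ?\<delta> z"
      using generator_apply[OF z, of ?\<delta>] by simp
  qed simp
  also have "\<dots> = (\<Sum>z\<in>\<Omega>. \<Sum>x\<in>star n. v z * rate z x * of_bool (z = flip \<xi> x) - v z * rate z x * ?\<delta> z)"
  proof (rule sum.cong)
    fix z assume z: "z \<in> \<Omega>"
    show "v z * gen ?\<delta> z = (\<Sum>x\<in>star n. v z * rate z x * of_bool (z = flip \<xi> x) - v z * rate z x * ?\<delta> z)"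
      unfolding gen_voter[OF z] sum_distrib_left
      by (intro sum.cong refl) (simp add: flip_iff[OF z] right_diff_distrib)
  qed simp
  also have "\<dots> = (\<Sum>x\<in>star n. \<Sum>z\<in>\<Omega>. v z * rate z x * of_bool (z = flip \<xi> x) - v z * rate z x * ?\<delta> z)"
    by (rule sum.swap)
  also have "\<dots> = (\<Sum>x\<in>star n. v (flip \<xi> x) * rate (flip \<xi> x) x - v \<xi> * rate \<xi> x)"
    by (intro sum.cong refl)
      (simp only: sum_subtractf sum_mult_delta[OF finite_states] \<xi> flip_in_configurations[OF \<xi>])
  finally show ?thesis .
qed

lemma ones_flip_Center: "ones n (flip \<xi> Center) = ones n \<xi>"
proof -
  have "{x \<in> leaves n. flip \<xi> Center x = 1} = {x \<in> leaves n. \<xi> x = 1}"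
    using Center_notin_leaves by (auto simp: flip_def)
  then show ?thesis by (simp add: ones_def)
qed

lemma ones_flip_leaf:
  assumes "\<xi> \<in> \<Omega>" "x \<in> leaves n"
  shows "ones n (flip \<xi> x) = (if \<xi> x = 1 then ones n \<xi> - 1 else ones n \<xi> + 1)"
proof (cases "\<xi> x = 1")
  case True
  then have "{y \<in> leaves n. flip \<xi> x y = 1} = {y \<in> leaves n. \<xi> y = 1} - {x}"
    by (auto simp: flip_def)
  then show ?thesis using True assms(2) finite_leaves by (simp add: ones_def)
next
  case False
  then have "\<xi> x = 0" using config_leaf[OF assms] by auto
  then have "{y \<in> leaves n. flip \<xi> x y = 1} = insert x {y \<in> leaves n. \<xi> y = 1}"
    using assms(2) by (auto simp: flip_def)
  then show ?thesis using False finite_leaves by (simp add: ones_def)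
qed

text \<open>
  The flow through a leaf depends only on the state of this leaf, the center and the number of ones:
  \<open>up\<close> is the net flow through a leaf in state 1 and \<open>down\<close> through a leaf in state 0, each counted once
  for every such leaf.
\<close>

lemma leaf_symmetric_adjoint:
  assumes "leaf_symmetric v"
  shows "leaf_symmetric (\<lambda>\<xi>. \<Sum>z\<in>\<Omega>. v z * generator \<Omega> (voter_rate (star n) (star_rate n)) z \<xi>)"
proof -
  obtain V where V: "\<And>\<xi>. \<xi> \<in> \<Omega> \<Longrightarrow> v \<xi> = V (\<xi> Center) (ones n \<xi>)"
    using leaf_symmetricE[OF assms] by blast
  define center where "center c k = (if c = 0 then 1/2 + real k / real n else 3/2 - real k / real n)"
    for c k :: nat
  define up where "up c k = V c (k - 1) * (1/2 + real c) - V c k * (3/2 - real c)" for c k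
  define down where "down c k = V c (k + 1) * (3/2 - real c) - V c k * (1/2 + real c)" for c k
  define W where "W c k = V (1 - c) k * center (1 - c) k - V c k * center c k
    + (down c k * real n + (up c k - down c k) * real k)" for c k
  show ?thesis
  proof (rule leaf_symmetricI[of _ W])
    fix \<xi> assume \<xi>: "\<xi> \<in> \<Omega>"
    have Center: "flip \<xi> Center \<in> \<Omega>" by (rule flip_in_configurations[OF \<xi> Center_in_star])
    have "v (flip \<xi> Center) * rate (flip \<xi> Center) Center - v \<xi> * rate \<xi> Center
        = V (1 - \<xi> Center) (ones n \<xi>) * center (1 - \<xi> Center) (ones n \<xi>)
          - V (\<xi> Center) (ones n \<xi>) * center (\<xi> Center) (ones n \<xi>)"
      by (simp add: V \<xi> Center flip_same ones_flip_Center center_def rate_Center)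
    moreover have "(\<Sum>x\<in>leaves n. v (flip \<xi> x) * rate (flip \<xi> x) x - v \<xi> * rate \<xi> x)
        = (\<Sum>x\<in>leaves n. down (\<xi> Center) (ones n \<xi>)
            + (up (\<xi> Center) (ones n \<xi>) - down (\<xi> Center) (ones n \<xi>)) * real (\<xi> x))"
    proof (rule sum.cong)
      fix x assume x: "x \<in> leaves n"
      have fx: "flip \<xi> x \<in> \<Omega>" by (rule flip_in_configurations[OF \<xi> leaf_in_star[OF x]])
      have "flip \<xi> x Center = \<xi> Center" using x Center_notin_leaves by (auto simp: flip_def)
      then show "v (flip \<xi> x) * rate (flip \<xi> x) x - v \<xi> * rate \<xi> x
          = down (\<xi> Center) (ones n \<xi>)
            + (up (\<xi> Center) (ones n \<xi>) - down (\<xi> Center) (ones n \<xi>)) * real (\<xi> x)"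
        using config_leaf[OF \<xi> x]
        by (auto simp: V \<xi> fx ones_flip_leaf x rate_leaf flip_same up_def down_def)
    qed simp
    moreover have "(\<Sum>x\<in>leaves n. a + b * real (\<xi> x)) = a * real n + b * real (ones n \<xi>)" for a b :: real
      by (simp add: sum.distrib card_leaves sum_distrib_left[symmetric] sum_leaves_ones[OF \<xi>])
    ultimately show "(\<Sum>z\<in>\<Omega>. v z * generator \<Omega> (voter_rate (star n) (star_rate n)) z \<xi>)
        = W (\<xi> Center) (ones n \<xi>)"
      unfolding generator_adjoint[OF \<xi>] sum_star W_def by simp
  qed
qed

lemma leaf_symmetric_law:
  assumes "leaf_symmetric v"
  shows "leaf_symmetric (\<lambda>\<xi>. \<Sum>z\<in>\<Omega>. v z * P t z \<xi>)"
proof -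
  let ?Q = "generator \<Omega> (voter_rate (star n) (star_rate n))"
  have power: "leaf_symmetric (\<lambda>\<xi>. \<Sum>z\<in>\<Omega>. v z * matrix_power \<Omega> ?Q k z \<xi>)" for k
  proof (induction k)
    case 0
    show ?case
      by (rule leaf_symmetric_cong[OF assms]) (use finite_states in \<open>simp add: if_distrib cong: if_cong\<close>)
  next
    case (Suc k)
    have "(\<Sum>z\<in>\<Omega>. v z * matrix_power \<Omega> ?Q (Suc k) z \<xi>)
        = (\<Sum>w\<in>\<Omega>. (\<Sum>z\<in>\<Omega>. v z * matrix_power \<Omega> ?Q k z w) * ?Q w \<xi>)" for \<xi>
      unfolding matrix_power.simps sum_distrib_left sum_distrib_right
      by (subst sum.swap) (simp add: mult.assoc)
    then show ?case using leaf_symmetric_adjoint[OF Suc.IH] by simp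
  qed
  have "(\<Sum>z\<in>\<Omega>. v z * P t z \<xi>)
      = (\<Sum>k. (\<Sum>z\<in>\<Omega>. v z * matrix_power \<Omega> ?Q k z \<xi>) / fact k * t ^ k)" if \<xi>: "\<xi> \<in> \<Omega>" for \<xi>
  proof -
    have "(\<Sum>z\<in>\<Omega>. v z * P t z \<xi>) = (\<Sum>z\<in>\<Omega>. \<Sum>k. v z * (matrix_power \<Omega> ?Q k z \<xi> / fact k * t ^ k))"
      unfolding law_series using \<xi> by (intro sum.cong suminf_mult[symmetric] summable_law_series) auto
    also have "\<dots> = (\<Sum>k. \<Sum>z\<in>\<Omega>. v z * (matrix_power \<Omega> ?Q k z \<xi> / fact k * t ^ k))"
      using \<xi> by (intro suminf_sum[symmetric] summable_mult summable_law_series) auto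
    also have "\<dots> = (\<Sum>k. (\<Sum>z\<in>\<Omega>. v z * matrix_power \<Omega> ?Q k z \<xi>) / fact k * t ^ k)"
      by (simp add: sum_divide_distrib sum_distrib_right mult.assoc)
    finally show ?thesis .
  qed
  moreover have "leaf_symmetric (\<lambda>\<xi>. \<Sum>k. (\<Sum>z\<in>\<Omega>. v z * matrix_power \<Omega> ?Q k z \<xi>) / fact k * t ^ k)"
    unfolding leaf_symmetric_def
  proof (intro ballI impI suminf_cong)
    fix \<xi> \<xi>' k assume "\<xi> \<in> \<Omega>" "\<xi>' \<in> \<Omega>" "leaf_class \<xi> = leaf_class \<xi>'"
    from leaf_symmetricD[OF power this]
    show "(\<Sum>z\<in>\<Omega>. v z * matrix_power \<Omega> ?Q k z \<xi>) / fact k * t ^ k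
        = (\<Sum>z\<in>\<Omega>. v z * matrix_power \<Omega> ?Q k z \<xi>') / fact k * t ^ k"
      by (simp only:)
  qed
  ultimately show ?thesis by (rule leaf_symmetric_cong[rotated])
qed

lemma all_ones_config: "all_ones n \<in> \<Omega>"
  by (auto simp: all_ones_def configurations_def)

lemma leaf_symmetric_law_all_ones: "leaf_symmetric (P t (all_ones n))"
proof -
  let ?\<delta> = "\<lambda>z. of_bool (z = all_ones n) :: real"
  have only: "\<xi> = all_ones n" if \<xi>: "\<xi> \<in> \<Omega>" "leaf_class \<xi> = leaf_class (all_ones n)" for \<xi>
  proof (rule configurations_eqI[OF \<xi>(1) all_ones_config])
    have "ones n (all_ones n) = n"
      by (simp add: ones_def all_ones_def leaf_in_star card_leaves cong: conj_cong)
    then have c: "\<xi> Center = 1" "card {x \<in> leaves n. \<xi> x = 1} = card (leaves n)"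
      using \<xi>(2) Center_in_star by (auto simp: leaf_class_def all_ones_def ones_def card_leaves)
    then have "{x \<in> leaves n. \<xi> x = 1} = leaves n"
      by (intro card_subset_eq finite_leaves) auto
    then show "\<xi> x = all_ones n x" if "x \<in> star n" for x
      using that c(1) by (auto simp: all_ones_def star_def)
  qed
  have "leaf_symmetric ?\<delta>"
    unfolding leaf_symmetric_def
  proof (intro ballI impI)
    fix \<xi> \<xi>' assume "\<xi> \<in> \<Omega>" "\<xi>' \<in> \<Omega>" "leaf_class \<xi> = leaf_class \<xi>'"
    then have "\<xi> = all_ones n \<longleftrightarrow> \<xi>' = all_ones n" using only by metis
    then show "?\<delta> \<xi> = ?\<delta> \<xi>'" by simp
  qed
  moreover have "(\<Sum>z\<in>\<Omega>. ?\<delta> z * P t z \<xi>) = P t (all_ones n) \<xi>" for \<xi>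
    unfolding mult.commute[of "?\<delta> _"] by (rule sum_mult_delta[OF finite_states all_ones_config])
  ultimately show ?thesis using leaf_symmetric_law[of ?\<delta> t] by simp
qed

lemma leaf_symmetric_stationary: "leaf_symmetric \<pi>"
  unfolding leaf_symmetric_def
proof (intro ballI impI)
  fix \<xi> \<xi>' assume \<xi>: "\<xi> \<in> \<Omega>" "\<xi>' \<in> \<Omega>" "leaf_class \<xi> = leaf_class \<xi>'"
  have "P (real m) (all_ones n) \<xi> = P (real m) (all_ones n) \<xi>'" for m
    by (rule leaf_symmetricD[OF leaf_symmetric_law_all_ones \<xi>])
  with stationary(4)[OF all_ones_config \<xi>(1)]
  have "(\<lambda>m. P (real m) (all_ones n) \<xi>') \<longlonglongrightarrow> \<pi> \<xi>" by (simp only:)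
  then show "\<pi> \<xi> = \<pi> \<xi>'"
    using stationary(4)[OF all_ones_config \<xi>(2)] by (rule LIMSEQ_unique)
qed

lemma leaf_class_range: "leaf_class ` \<Omega> \<subseteq> {0, 1} \<times> {..n}"
  using config_Center ones_le by (fastforce simp: leaf_class_def)

lemma sum_leaf_classes:
  "(\<Sum>y\<in>{0, 1} \<times> {..n}. \<Sum>\<xi> | \<xi> \<in> \<Omega> \<and> leaf_class \<xi> = y. f \<xi>) = (\<Sum>\<xi>\<in>\<Omega>. f \<xi>)" for f :: "_ \<Rightarrow> real"
  by (rule sum.group[OF finite_states _ leaf_class_range]) simp

text \<open>
  A symmetric measure is constant on each class, so no cancellation occurs when it is summed there.
\<close>

lemma leaf_symmetric_norm:
  assumes "leaf_symmetric v"
  shows "(\<Sum>\<xi>\<in>\<Omega>. \<bar>v \<xi>\<bar>) = (\<Sum>y\<in>{0, 1} \<times> {..n}. \<bar>\<Sum>\<xi> | \<xi> \<in> \<Omega> \<and> leaf_class \<xi> = y. v \<xi>\<bar>)"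
proof -
  have "(\<Sum>\<xi> | \<xi> \<in> \<Omega> \<and> leaf_class \<xi> = y. \<bar>v \<xi>\<bar>) = \<bar>\<Sum>\<xi> | \<xi> \<in> \<Omega> \<and> leaf_class \<xi> = y. v \<xi>\<bar>" for y
  proof (cases "\<exists>\<zeta>\<in>\<Omega>. leaf_class \<zeta> = y")
    case True
    then obtain \<zeta> where \<zeta>: "\<zeta> \<in> \<Omega>" "leaf_class \<zeta> = y" by blast
    have "v \<xi> = v \<zeta>" if "\<xi> \<in> {\<xi>. \<xi> \<in> \<Omega> \<and> leaf_class \<xi> = y}" for \<xi>
      using \<zeta> that by (intro leaf_symmetricD[OF assms]) auto
    then have "(\<Sum>\<xi> | \<xi> \<in> \<Omega> \<and> leaf_class \<xi> = y. \<bar>v \<xi>\<bar>) = (\<Sum>\<xi> | \<xi> \<in> \<Omega> \<and> leaf_class \<xi> = y. \<bar>v \<zeta>\<bar>)"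
      "(\<Sum>\<xi> | \<xi> \<in> \<Omega> \<and> leaf_class \<xi> = y. v \<xi>) = (\<Sum>\<xi> | \<xi> \<in> \<Omega> \<and> leaf_class \<xi> = y. v \<zeta>)"
      by (auto intro!: sum.cong)
    then show ?thesis by (simp add: abs_mult)
  next
    case False
    then have "{\<xi>. \<xi> \<in> \<Omega> \<and> leaf_class \<xi> = y} = {}" by auto
    then show ?thesis by (simp only: sum.empty abs_zero)
  qed
  then show ?thesis unfolding sum_leaf_classes[symmetric] by simp
qed

end

section \<open>Fast mixing from the constant configuration\<close>

definition contraction_rate :: real where
  "contraction_rate = exp (- 3/2 * half_time) / 16384"

lemma contraction_rate: "0 < contraction_rate" "contraction_rate < 1"
proof -
  have "exp (- 3/2 * half_time) \<le> 1" using half_time(1) by simp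
  then have "exp (- 3/2 * half_time) < 16384" by linarith
  then show "0 < contraction_rate" "contraction_rate < 1"
    by (simp_all add: contraction_rate_def)
qed

context star_model
begin

text \<open>
  The Doeblin condition for the kernel followed by the projection to classes: the window contains at
  least \<open>n / 16\<close> values of \<open>j\<close>, each of weight \<open>const / n\<close>.
\<close>

lemma norm_contraction:
  assumes n: "656 \<le> n" and v: "leaf_symmetric v" "(\<Sum>z\<in>\<Omega>. v z) = 0"
  shows "(\<Sum>\<xi>\<in>\<Omega>. \<bar>\<Sum>z\<in>\<Omega>. v z * P (6 * half_time) z \<xi>\<bar>) \<le> (1 - contraction_rate) * (\<Sum>z\<in>\<Omega>. \<bar>v z\<bar>)"
proof -
  let ?T = "6 * half_time" and ?Y = "{0::nat, 1} \<times> {..n}"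
  define \<theta> where "\<theta> = exp (- 3/2 * half_time) / (1024 * real n)"
  define J where "J = {j. 5 * n \<le> 16 * j \<and> 16 * j \<le> 7 * n}"
  define K where "K z y = (\<Sum>\<xi> | \<xi> \<in> \<Omega> \<and> leaf_class \<xi> = y. P ?T z \<xi>)" for z y
  define \<omega> where "\<omega> y = (if y \<in> {0} \<times> J then \<theta> else 0)" for y :: "nat \<times> nat"
  have T: "0 \<le> ?T" using half_time(1) by simp
  have "(\<Sum>\<xi>\<in>\<Omega>. \<bar>\<Sum>z\<in>\<Omega>. v z * P ?T z \<xi>\<bar>)
      = (\<Sum>y\<in>?Y. \<bar>\<Sum>\<xi> | \<xi> \<in> \<Omega> \<and> leaf_class \<xi> = y. \<Sum>z\<in>\<Omega>. v z * P ?T z \<xi>\<bar>)"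
    by (rule leaf_symmetric_norm[OF leaf_symmetric_law[OF v(1)]])
  also have "\<dots> = (\<Sum>y\<in>?Y. \<bar>\<Sum>z\<in>\<Omega>. v z * K z y\<bar>)"
    unfolding K_def sum_distrib_left by (subst sum.swap) simp
  also have "\<dots> \<le> (1 - (\<Sum>y\<in>?Y. \<omega> y)) * (\<Sum>z\<in>\<Omega>. \<bar>v z\<bar>)"
  proof (rule doeblin_contraction)
    fix z y assume z: "z \<in> \<Omega>"
    show "\<omega> y \<le> K z y"
    proof (cases "y \<in> {0} \<times> J")
      case True
      then obtain j where "y = (0, j)" "5 * n \<le> 16 * j" "16 * j \<le> 7 * n" by (auto simp: J_def)
      then show ?thesis using law_class_ge[OF n _ _ z, of j] True by (simp add: \<omega>_def K_def \<theta>_def)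
    next
      case False
      have "0 \<le> K z y" unfolding K_def by (intro sum_nonneg law_nonneg T z) auto
      then show ?thesis using False by (simp add: \<omega>_def)
    qed
  next
    show "(\<Sum>y\<in>?Y. K z y) = 1" if "z \<in> \<Omega>" for z
      unfolding K_def sum_leaf_classes by (rule law_sum[OF T that])
  qed (rule v(2))
  also have "\<dots> \<le> (1 - contraction_rate) * (\<Sum>z\<in>\<Omega>. \<bar>v z\<bar>)"
  proof (intro mult_right_mono diff_left_mono)
    have sub: "{0::nat} \<times> J \<subseteq> ?Y" by (auto simp: J_def)
    have J_fin: "finite J" by (rule finite_subset[of _ "{..n}"]) (auto simp: J_def)
    have "(\<Sum>y\<in>?Y. \<omega> y) = (\<Sum>y\<in>{0::nat} \<times> J. \<theta>)"
      using sub by (intro sum.mono_neutral_cong_right finite_cartesian_product) (auto simp: \<omega>_def)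
    then have sum_\<omega>: "(\<Sum>y\<in>?Y. \<omega> y) = real (card J) * \<theta>"
      by (simp add: card_cartesian_product)
    \<comment> \<open>the lower end is \<open>5 n / 16\<close> rounded up\<close>
    have "card {(5 * n + 15) div 16..7 * n div 16} \<le> card J"
    proof (rule card_mono[OF J_fin])
      show "{(5 * n + 15) div 16..7 * n div 16} \<subseteq> J" by (auto simp: J_def)
    qed
    moreover have "n \<le> 16 * card {(5 * n + 15) div 16..7 * n div 16}" using n by simp
    ultimately have "n \<le> 16 * card J" by linarith
    then have "real n / 16 \<le> real (card J)" by linarith
    then have "real n / 16 * \<theta> \<le> real (card J) * \<theta>"
      by (intro mult_right_mono) (auto simp: \<theta>_def)
    moreover have "contraction_rate = real n / 16 * \<theta>"
      using n_pos by (simp add: contraction_rate_def \<theta>_def)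
    ultimately show "contraction_rate \<le> (\<Sum>y\<in>?Y. \<omega> y)" unfolding sum_\<omega> by simp
  qed (simp add: sum_nonneg)
  finally show ?thesis .
qed

lemma tv_all_ones_le:
  assumes n: "656 \<le> n"
  shows "tv_dist \<Omega> (P (real m * (6 * half_time)) (all_ones n)) \<pi> \<le> (1 - contraction_rate) ^ m"
proof -
  let ?T = "6 * half_time"
  have T: "0 \<le> real m * ?T" for m using half_time(1) by simp
  have c: "0 \<le> 1 - contraction_rate" using contraction_rate(2) by simp
  have "(\<Sum>\<xi>\<in>\<Omega>. \<bar>P (real m * ?T) (all_ones n) \<xi> - \<pi> \<xi>\<bar>) \<le> 2 * (1 - contraction_rate) ^ m"
  proof (induction m)
    case 0
    have "(\<Sum>\<xi>\<in>\<Omega>. \<bar>P 0 (all_ones n) \<xi> - \<pi> \<xi>\<bar>) \<le> (\<Sum>\<xi>\<in>\<Omega>. P 0 (all_ones n) \<xi> + \<pi> \<xi>)"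
    proof (rule sum_mono)
      fix \<xi> assume "\<xi> \<in> \<Omega>"
      then have "0 \<le> P 0 (all_ones n) \<xi>" "0 \<le> \<pi> \<xi>"
        using law_nonneg[of 0 "all_ones n" \<xi>] all_ones_config stationary(1) by auto
      then show "\<bar>P 0 (all_ones n) \<xi> - \<pi> \<xi>\<bar> \<le> P 0 (all_ones n) \<xi> + \<pi> \<xi>" by linarith
    qed
    also have "\<dots> = 2"
      using law_sum[of 0 "all_ones n"] all_ones_config stationary(2) by (simp add: sum.distrib)
    finally show ?case by simp
  next
    case (Suc m)
    let ?v = "\<lambda>\<xi>. P (real m * ?T) (all_ones n) \<xi> - \<pi> \<xi>"
    have sym: "leaf_symmetric ?v"
      unfolding leaf_symmetric_def
      by (intro ballI impI arg_cong2[where f = "(-)"] leaf_symmetricD[OF leaf_symmetric_law_all_ones]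
          leaf_symmetricD[OF leaf_symmetric_stationary])
    have mass: "(\<Sum>\<xi>\<in>\<Omega>. ?v \<xi>) = 0"
      using law_sum[OF T all_ones_config] stationary(2) by (simp add: sum_subtractf)
    have "P (real (Suc m) * ?T) (all_ones n) \<xi> - \<pi> \<xi> = (\<Sum>z\<in>\<Omega>. ?v z * P ?T z \<xi>)" if "\<xi> \<in> \<Omega>" for \<xi>
    proof -
      have "P (real (Suc m) * ?T) (all_ones n) \<xi> = P (real m * ?T + ?T) (all_ones n) \<xi>"
        by (simp add: algebra_simps)
      also have "\<dots> = (\<Sum>z\<in>\<Omega>. P (real m * ?T) (all_ones n) z * P ?T z \<xi>)"
        using T[of m] half_time(1) that by (intro law_add all_ones_config) auto
      finally show ?thesis
        using stationary(3)[of ?T \<xi>] half_time(1) that by (simp add: left_diff_distrib sum_subtractf)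
    qed
    then have "(\<Sum>\<xi>\<in>\<Omega>. \<bar>P (real (Suc m) * ?T) (all_ones n) \<xi> - \<pi> \<xi>\<bar>)
        = (\<Sum>\<xi>\<in>\<Omega>. \<bar>\<Sum>z\<in>\<Omega>. ?v z * P ?T z \<xi>\<bar>)" by (intro sum.cong) auto
    also have "\<dots> \<le> (1 - contraction_rate) * (\<Sum>\<xi>\<in>\<Omega>. \<bar>?v \<xi>\<bar>)"
      by (rule norm_contraction[OF n sym mass])
    also have "\<dots> \<le> (1 - contraction_rate) * (2 * (1 - contraction_rate) ^ m)"
      by (intro mult_left_mono Suc.IH c)
    finally show ?case by simp
  qed
  then show ?thesis by (simp add: tv_dist_def)
qed

lemma tv_tendsto_0:
  assumes "\<eta> \<in> \<Omega>"
  shows "(\<lambda>m. tv_dist \<Omega> (P (real m) \<eta>) \<pi>) \<longlonglongrightarrow> 0"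
proof -
  have "(\<lambda>m. 1/2 * (\<Sum>\<xi>\<in>\<Omega>. \<bar>P (real m) \<eta> \<xi> - \<pi> \<xi>\<bar>)) \<longlonglongrightarrow> 1/2 * (\<Sum>\<xi>\<in>\<Omega>. \<bar>\<pi> \<xi> - \<pi> \<xi>\<bar>)"
    by (intro tendsto_intros stationary(4) assms)
  then show ?thesis by (simp add: tv_dist_def)
qed

end

text \<open>
  One multiple of the contraction time serves all \<open>n \<ge> 656\<close>; the maximum over the finitely many other
  \<open>n\<close> is taken of times that exist by convergence.
\<close>

lemma mixing_from_all_ones_bounded:
  obtains K :: real where
    "\<And>n. 0 < n \<Longrightarrow> \<exists>t. 0 \<le> t \<and> t \<le> K \<and>
      tv_dist (configurations (star n)) (star_voter_law n (all_ones n) t) (star_voter_stationary n) \<le> 1/4"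
proof -
  define tv where "tv n t = tv_dist (configurations (star n)) (star_voter_law n (all_ones n) t)
    (star_voter_stationary n)" for n t
  have unfold: "tv n t = tv_dist (configurations (star n))
      (ctmc_law (configurations (star n)) (voter_rate (star n) (star_rate n)) (all_ones n) t)
      (stationary_distribution (configurations (star n)) (voter_rate (star n) (star_rate n)))" for n t
    by (simp add: tv_def star_voter_law_def star_voter_stationary_def voter_law_def voter_stationary_def)
  have "\<forall>\<^sub>F m in sequentially. (1 - contraction_rate) ^ m < 1/4"
    using contraction_rate
    by (intro order_tendstoD(2)[OF LIMSEQ_power_zero]) auto
  then obtain m where m: "(1 - contraction_rate) ^ m < 1/4" by (auto simp: eventually_sequentially)
  have large: "tv n (real m * (6 * half_time)) \<le> 1/4" if "656 \<le> n" for n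
  proof -
    interpret star_model n using that by unfold_locales simp
    show ?thesis using tv_all_ones_le[OF that, of m] m by (simp add: unfold)
  qed
  have "\<exists>t\<ge>0. 0 < n \<longrightarrow> tv n t \<le> 1/4" for n
  proof (cases "0 < n")
    case True
    then interpret star_model n by unfold_locales
    have "\<forall>\<^sub>F m in sequentially. tv n (real m) < 1/4"
      unfolding unfold by (intro order_tendstoD(2)[OF tv_tendsto_0] all_ones_config) auto
    then obtain m where "tv n (real m) < 1/4" by (auto simp: eventually_sequentially)
    then show ?thesis by (intro exI[of _ "real m"]) auto
  qed auto
  then obtain s where s: "\<And>n. 0 \<le> s n" "\<And>n. 0 < n \<Longrightarrow> tv n (s n) \<le> 1/4" by metis
  define K where "K = Max (insert (real m * (6 * half_time)) (s ` {..<656}))"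
  have "\<exists>t. 0 \<le> t \<and> t \<le> K \<and> tv n t \<le> 1/4" if "0 < n" for n
  proof (cases "656 \<le> n")
    case True
    have "real m * (6 * half_time) \<le> K" unfolding K_def by (intro Max_ge) auto
    then show ?thesis using large[OF True] half_time(1) by (intro exI[of _ "real m * (6 * half_time)"]) auto
  next
    case False
    then have "s n \<le> K" unfolding K_def by (intro Max_ge) auto
    then show ?thesis using s that by blast
  qed
  then show ?thesis using that unfolding tv_def by blast
qed

theorem theorem2:
  "(\<forall>n \<eta>\<^sub>0 (C::real) t.
      even n \<and> n \<ge> 3 \<and>
      \<eta>\<^sub>0 \<in> configurations (star n) \<and>
      card {x \<in> leaves n. \<eta>\<^sub>0 x = 1} = n div 2 \<and>
      t = 1/4 * (ln (real n) - C) \<and> t > 0 \<longrightarrow>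
      tv_dist (configurations (star n)) (star_voter_law n \<eta>\<^sub>0 t) (star_voter_stationary n)
        \<ge> exp C / (48 + exp C)) \<and>
   (\<exists>K::real. \<forall>n. even n \<and> n > 0 \<longrightarrow>
      (INF t \<in> {t. t \<ge> 0 \<and>
          tv_dist (configurations (star n)) (star_voter_law n (all_ones n) t)
            (star_voter_stationary n) \<le> 1/4}. ereal t) \<le> ereal K)"
proof (intro conjI allI impI)
  fix n :: nat and \<eta>\<^sub>0 and C t :: real
  assume *: "even n \<and> n \<ge> 3 \<and>
      \<eta>\<^sub>0 \<in> configurations (star n) \<and>
      card {x \<in> leaves n. \<eta>\<^sub>0 x = 1} = n div 2 \<and>
      t = 1/4 * (ln (real n) - C) \<and> t > 0"
  then interpret star_model n by unfold_locales auto
  have "- 4 * t = C - ln (real n)" using * by simp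
  then have E: "real n * exp (- 4 * t) = exp C" using n_pos by (simp add: exp_diff)
  have "exp C / (48 + exp C) \<le> exp C / (6 + exp C)"
    by (intro divide_left_mono) (auto intro!: mult_pos_pos add_pos_pos)
  also have "\<dots> \<le> tv_dist (configurations (star n)) (star_voter_law n \<eta>\<^sub>0 t) (star_voter_stationary n)"
  proof -
    have \<eta>: "\<eta>\<^sub>0 \<in> \<Omega>" "ones n \<eta>\<^sub>0 = n div 2" "even n" "0 < t" using * by (simp_all add: ones_def)
    show ?thesis
      using tv_lower_bound[OF \<eta>] unfolding E
      by (simp add: star_voter_law_def star_voter_stationary_def voter_law_def voter_stationary_def)
  qed
  finally show "tv_dist (configurations (star n)) (star_voter_law n \<eta>\<^sub>0 t) (star_voter_stationary n)
        \<ge> exp C / (48 + exp C)" .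
next
  obtain K where K: "\<And>n. 0 < n \<Longrightarrow> \<exists>t. 0 \<le> t \<and> t \<le> K \<and>
      tv_dist (configurations (star n)) (star_voter_law n (all_ones n) t) (star_voter_stationary n) \<le> 1/4"
    using mixing_from_all_ones_bounded by blast
  show "\<exists>K::real. \<forall>n. even n \<and> n > 0 \<longrightarrow>
      (INF t \<in> {t. t \<ge> 0 \<and>
          tv_dist (configurations (star n)) (star_voter_law n (all_ones n) t)
            (star_voter_stationary n) \<le> 1/4}. ereal t) \<le> ereal K"
  proof (intro exI[of _ K] allI impI)
    fix n :: nat assume "even n \<and> n > 0"
    then obtain t where t: "0 \<le> t" "t \<le> K" "tv_dist (configurations (star n))
        (star_voter_law n (all_ones n) t) (star_voter_stationary n) \<le> 1/4"
      using K by blast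
    then show "(INF t \<in> {t. t \<ge> 0 \<and>
          tv_dist (configurations (star n)) (star_voter_law n (all_ones n) t)
            (star_voter_stationary n) \<le> 1/4}. ereal t) \<le> ereal K"
      by (intro INF_lower2[of t]) auto
  qed
qed

end
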